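(* Let $\mathcal{G}$ be a group prevariety and let $\mathcal{A}=(Q,\delta)$ be an NFA (without $\varepsilon$-transitions). Then $\mathcal{I}_{BPol(\mathcal{G}^+)}[\mathcal{G},\mathcal{A}]$ is the greatest (for inclusion) $(BPol,+)$-sound subset of $Q^4$ for $\mathcal{G}$ and $\mathcal{A}$.
   Context: Fix a finite alphabet $A$; languages are subsets of $A^*$, $A^+=A^*\setminus\{\varepsilon\}$, and a class is a set of languages. A lattice is a class containing $\emptyset$ and $A^*$ and closed under union and intersection; a Boolean algebra is a lattice closed under complement. A prevariety is a Boolean algebra of regular languages closed under quotients ($L\mapsto v^{-1}L=\{w\mid vw\in L\}$ and $L\mapsto Lv^{-1}=\{w\mid wv\in L\}$ for $v\in A^*$). A group language is a language of the form $\eta^{-1}(F)$ for a morphism $\eta:A^*\to G$ into a finite group and $F\subseteq G$. A group prevariety is a prevariety containing only group languages. For a class $\mathcal{C}$, $\mathcal{C}^+$ is the class of all languages of the form $L\cap A^+$ or $L\cup\{\varepsilon\}$ with $L\in\mathcal{C}$. $Pol(\mathcal{C})$ is the class of all finite unions of languages $L_0a_1L_1\cdots a_nL_n$ with $n\ge 0$, $a_i\in A$, $L_i\in\mathcal{C}$. $BPol(\mathcal{C})$ is the least Boolean algebra containing $Pol(\mathcal{C})$. An NFA is a pair $\mathcal{A}=(Q,\delta)$ with $Q$ a finite set of states and $\delta\subseteq Q\times A\times Q$; $L_{\mathcal{A}}(q,r)$ is the set of words labeling a run from $q$ to $r$ (the empty run gives $\varepsilon\in L_{\mathcal{A}}(q,q)$).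 For NFAs with $\varepsilon$-transitions (transitions labeled in $A\cup\{\varepsilon\}$) the same notation is used with the standard semantics. $L_0$ is $\mathcal{C}$-separable from $L_1$ if there is $K\in\mathcal{C}$ with $L_0\subseteq K$ and $K\cap L_1=\emptyset$. $L_0$ is $\mathcal{C}$-separable from $L_1$ under $\mathcal{D}$-control if there is $H\in\mathcal{D}$ with $\varepsilon\in H$ such that $L_0\cap H$ is $\mathcal{C}$-separable from $L_1\cap H$. Define $$\mathcal{I}_{\mathcal{C}}[\mathcal{D},\mathcal{A}]=\{(q,r,s,t)\in Q^4\mid L_{\mathcal{A}}(q,r)\text{ is not }\mathcal{C}\text{-separable from }L_{\mathcal{A}}(s,t)\text{ under }\mathcal{D}\text{-control}\}.$$ For $S\subseteq Q^4$, let $\mathcal{B}^+_S=(Q^3,\gamma^+_S)$ be the NFA with $\varepsilon$-transitions whose transitions are: (i) $((s_1,s_2,s_3),a,(t_1,t_2,t_3))$ for $a\in A$ and $(s_i,a,t_i)\in\delta$ for $i=1,2,3$; (ii) $((q_1,q_2,q_3),\varepsilon,(q_1,r_2,r_3))$ for every $q_1\in Q$ and every $(q_2,r_2,q_3,r_3)\in S$ such that $A^+\cap L_{\mathcal{A}}(q_1,q_1)\cap L_{\mathcal{A}}(q_2,q_2)\cap L_{\mathcal{A}}(q_3,q_3)\cap L_{\mathcal{A}}(r_2,r_2)\cap L_{\mathcal{A}}(r_3,r_3)\neq\emptyset$. Define $\tau^+_{\mathcal{A},\mathcal{G}}(S)\subseteq Q^4$ as the set of all $(q,r,s,t)\in Q^4$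 such that $\{\varepsilon\}$ is not $\mathcal{G}$-separable from $L_{\mathcal{B}^+_S}((s,q,s),(t,r,t))$ and $\{\varepsilon\}$ is not $\mathcal{G}$-separable from $L_{\mathcal{B}^+_S}((q,s,q),(r,t,r))$. A set $S\subseteq Q^4$ is $(BPol,+)$-sound for $\mathcal{G}$ and $\mathcal{A}$ if $\tau^+_{\mathcal{A},\mathcal{G}}(S)=S$. (The map $\tau^+_{\mathcal{A},\mathcal{G}}$ is monotone for inclusion, so a greatest such set exists.) *)

theory Defs
  imports "HOL-Algebra.Group"
begin

text \<open>The alphabet is a type \<open>'a\<close> of class \<open>finite\<close>; words are lists over \<open>'a\<close>.\<close>

type_synonym 'a lang = "'a list set"
type_synonym 'a lang_class = "'a lang set"

definition nonempty_words :: "'a lang" where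
  "nonempty_words = - {[]}"

text \<open>An NFA is given by a state set \<open>Q\<close> and a transition relation \<open>\<delta>\<close>. The languages
  \<open>L(q,r)\<close> depend on \<open>\<delta>\<close> only and are used only for states \<open>q\<close>, \<open>r\<close> in \<open>Q\<close>.\<close>

definition is_nfa :: "'q set \<Rightarrow> ('q \<times> 'a \<times> 'q) set \<Rightarrow> bool" where
  "is_nfa Q \<delta> \<longleftrightarrow> finite Q \<and> \<delta> \<subseteq> Q \<times> UNIV \<times> Q"

inductive nfa_run :: "('q \<times> 'a \<times> 'q) set \<Rightarrow> 'q \<Rightarrow> 'a list \<Rightarrow> 'q \<Rightarrow> bool"
  for \<delta> where
  nfa_run_Nil: "nfa_run \<delta> q [] q"
| nfa_run_Cons: "(q, a, r) \<in> \<delta> \<Longrightarrow> nfa_run \<delta> r w s \<Longrightarrow> nfa_run \<delta> q (a # w) s"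

definition nfa_lang :: "('q \<times> 'a \<times> 'q) set \<Rightarrow> 'q \<Rightarrow> 'q \<Rightarrow> 'a lang" where
  "nfa_lang \<delta> q r = {w. nfa_run \<delta> q w r}"

text \<open>In an NFA with \<open>\<epsilon>\<close>-transitions, the label \<open>None\<close> stands for \<open>\<epsilon>\<close>.\<close>

inductive eps_run :: "('q \<times> 'a option \<times> 'q) set \<Rightarrow> 'q \<Rightarrow> 'a list \<Rightarrow> 'q \<Rightarrow> bool"
  for \<gamma> where
  eps_run_Nil: "eps_run \<gamma> q [] q"
| eps_run_eps: "(q, None, r) \<in> \<gamma> \<Longrightarrow> eps_run \<gamma> r w s \<Longrightarrow> eps_run \<gamma> q w s"
| eps_run_Cons: "(q, Some a, r) \<in> \<gamma> \<Longrightarrow> eps_run \<gamma> r w s \<Longrightarrow> eps_run \<gamma> q (a # w) s"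

definition eps_lang :: "('q \<times> 'a option \<times> 'q) set \<Rightarrow> 'q \<Rightarrow> 'q \<Rightarrow> 'a lang" where
  "eps_lang \<gamma> q r = {w. eps_run \<gamma> q w r}"

text \<open>Taking the states in \<open>nat\<close> is no restriction, see \<open>regular_langI\<close> below.\<close>

definition regular_lang :: "'a lang \<Rightarrow> bool" where
  "regular_lang L \<longleftrightarrow> (\<exists>(Q :: nat set) \<delta> I F. is_nfa Q \<delta> \<and> I \<subseteq> Q \<and> F \<subseteq> Q \<and>
     L = (\<Union>q\<in>I. \<Union>r\<in>F. nfa_lang \<delta> q r))"

definition free_monoid :: "'a list monoid" where
  "free_monoid = \<lparr>carrier = UNIV, mult = (@), one = []\<rparr>"

text \<open>A multiplicative map into a group preserves the neutral element, so the elements of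
  \<open>hom free_monoid G\<close> are the monoid morphisms into \<open>G\<close>. Taking the elements of \<open>G\<close> in \<open>nat\<close>
  is no restriction, see \<open>group_langI\<close> below.\<close>

definition group_lang :: "'a lang \<Rightarrow> bool" where
  "group_lang L \<longleftrightarrow> (\<exists>(G :: nat monoid) \<eta> F. group G \<and> finite (carrier G) \<and>
     \<eta> \<in> hom free_monoid G \<and> F \<subseteq> carrier G \<and> L = \<eta> -` F)"

definition lang_lattice :: "'a lang_class \<Rightarrow> bool" where
  "lang_lattice C \<longleftrightarrow> {} \<in> C \<and> UNIV \<in> C \<and> (\<forall>K\<in>C. \<forall>L\<in>C. K \<union> L \<in> C \<and> K \<inter> L \<in> C)"

definition lang_boolean_algebra :: "'a lang_class \<Rightarrow> bool" where
  "lang_boolean_algebra C \<longleftrightarrow> lang_lattice C \<and> (\<forall>L\<in>C. - L \<in> C)"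

definition left_quotient :: "'a list \<Rightarrow> 'a lang \<Rightarrow> 'a lang" where
  "left_quotient v L = {w. v @ w \<in> L}"

definition right_quotient :: "'a lang \<Rightarrow> 'a list \<Rightarrow> 'a lang" where
  "right_quotient L v = {w. w @ v \<in> L}"

definition prevariety :: "'a lang_class \<Rightarrow> bool" where
  "prevariety C \<longleftrightarrow> lang_boolean_algebra C \<and> (\<forall>L\<in>C. regular_lang L) \<and>
     (\<forall>L\<in>C. \<forall>v. left_quotient v L \<in> C \<and> right_quotient L v \<in> C)"

definition group_prevariety :: "'a lang_class \<Rightarrow> bool" where
  "group_prevariety C \<longleftrightarrow> prevariety C \<and> (\<forall>L\<in>C. group_lang L)"

definition lang_class_plus :: "'a lang_class \<Rightarrow> 'a lang_class" where
  "lang_class_plus C = {L \<inter> nonempty_words | L. L \<in> C} \<union> {L \<union> {[]} | L. L \<in> C}"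

text \<open>\<open>marked_product L\<^sub>0 [(a\<^sub>1, L\<^sub>1), \<dots>, (a\<^sub>n, L\<^sub>n)]\<close> is \<open>L\<^sub>0 a\<^sub>1 L\<^sub>1 \<dots> a\<^sub>n L\<^sub>n\<close>.\<close>

fun marked_product :: "'a lang \<Rightarrow> ('a \<times> 'a lang) list \<Rightarrow> 'a lang" where
  "marked_product L [] = L"
| "marked_product L ((a, K) # ps) = {u @ a # v | u v. u \<in> L \<and> v \<in> marked_product K ps}"

definition Pol :: "'a lang_class \<Rightarrow> 'a lang_class" where
  "Pol C = {\<Union>M | M. finite M \<and>
     M \<subseteq> {marked_product L ps | L ps. L \<in> C \<and> (\<forall>(a, K) \<in> set ps. K \<in> C)}}"

definition BPol :: "'a lang_class \<Rightarrow> 'a lang_class" where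
  "BPol C = \<Inter>{B. lang_boolean_algebra B \<and> Pol C \<subseteq> B}"

definition separable :: "'a lang_class \<Rightarrow> 'a lang \<Rightarrow> 'a lang \<Rightarrow> bool" where
  "separable C L0 L1 \<longleftrightarrow> (\<exists>K\<in>C. L0 \<subseteq> K \<and> K \<inter> L1 = {})"

definition separable_under_control ::
  "'a lang_class \<Rightarrow> 'a lang_class \<Rightarrow> 'a lang \<Rightarrow> 'a lang \<Rightarrow> bool" where
  "separable_under_control C D L0 L1 \<longleftrightarrow> (\<exists>H\<in>D. [] \<in> H \<and> separable C (L0 \<inter> H) (L1 \<inter> H))"

definition inseparable_quads ::
  "'a lang_class \<Rightarrow> 'a lang_class \<Rightarrow> 'q set \<Rightarrow> ('q \<times> 'a \<times> 'q) set \<Rightarrow> ('q \<times> 'q \<times> 'q \<times> 'q) set" where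
  "inseparable_quads C D Q \<delta> = {(q, r, s, t) \<in> Q \<times> Q \<times> Q \<times> Q.
     \<not> separable_under_control C D (nfa_lang \<delta> q r) (nfa_lang \<delta> s t)}"

definition gamma_plus ::
  "'q set \<Rightarrow> ('q \<times> 'a \<times> 'q) set \<Rightarrow> ('q \<times> 'q \<times> 'q \<times> 'q) set \<Rightarrow>
   (('q \<times> 'q \<times> 'q) \<times> 'a option \<times> ('q \<times> 'q \<times> 'q)) set" where
  "gamma_plus Q \<delta> S =
     {((s1, s2, s3), Some a, (t1, t2, t3)) | s1 s2 s3 a t1 t2 t3.
        (s1, a, t1) \<in> \<delta> \<and> (s2, a, t2) \<in> \<delta> \<and> (s3, a, t3) \<in> \<delta>} \<union>
     {((q1, q2, q3), None, (q1, r2, r3)) | q1 q2 q3 r2 r3.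
        q1 \<in> Q \<and> (q2, r2, q3, r3) \<in> S \<and>
        nonempty_words \<inter> nfa_lang \<delta> q1 q1 \<inter> nfa_lang \<delta> q2 q2 \<inter> nfa_lang \<delta> q3 q3 \<inter>
          nfa_lang \<delta> r2 r2 \<inter> nfa_lang \<delta> r3 r3 \<noteq> {}}"

definition tau_plus ::
  "'a lang_class \<Rightarrow> 'q set \<Rightarrow> ('q \<times> 'a \<times> 'q) set \<Rightarrow>
   ('q \<times> 'q \<times> 'q \<times> 'q) set \<Rightarrow> ('q \<times> 'q \<times> 'q \<times> 'q) set" where
  "tau_plus G Q \<delta> S = {(q, r, s, t) \<in> Q \<times> Q \<times> Q \<times> Q.
     \<not> separable G {[]} (eps_lang (gamma_plus Q \<delta> S) (s, q, s) (t, r, t)) \<and>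
     \<not> separable G {[]} (eps_lang (gamma_plus Q \<delta> S) (q, s, q) (r, t, r))}"

definition BPol_plus_sound ::
  "'a lang_class \<Rightarrow> 'q set \<Rightarrow> ('q \<times> 'a \<times> 'q) set \<Rightarrow> ('q \<times> 'q \<times> 'q \<times> 'q) set \<Rightarrow> bool" where
  "BPol_plus_sound G Q \<delta> S \<longleftrightarrow> S \<subseteq> Q \<times> Q \<times> Q \<times> Q \<and> tau_plus G Q \<delta> S = S"

lemma regular_langI:
  fixes Q :: "'q set"
  assumes nfa: "is_nfa Q \<delta>" and I: "I \<subseteq> Q" and F: "F \<subseteq> Q"
  shows "regular_lang (\<Union>q\<in>I. \<Union>r\<in>F. nfa_lang \<delta> q r)"
proof -
  have fin: "finite Q" and sub: "\<delta> \<subseteq> Q \<times> UNIV \<times> Q"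
    using nfa by (auto simp: is_nfa_def)
  obtain f :: "'q \<Rightarrow> nat" where f: "inj_on f Q"
    using finite_imp_inj_to_nat_seg[OF fin] by blast
  define \<delta>' where "\<delta>' = (\<lambda>(q, a, r). (f q, a, f r)) ` \<delta>"
  have fwd: "nfa_run \<delta>' (f q) w (f r)" if "nfa_run \<delta> q w r" for q w r
    using that
  proof induction
    case (nfa_run_Cons q a r w s)
    have "(f q, a, f r) \<in> \<delta>'"
      using nfa_run_Cons.hyps(1) unfolding \<delta>'_def by force
    then show ?case
      using nfa_run_Cons.IH by (rule nfa_run.nfa_run_Cons)
  qed (rule nfa_run_Nil)
  have bwd: "nfa_run \<delta> q w r" if "nfa_run \<delta>' x w y" "x = f q" "y = f r" "q \<in> Q" "r \<in> Q"
    for x w y q r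
    using that
  proof (induction arbitrary: q)
    case (nfa_run_Nil x)
    then have "q = r"
      using f by (metis inj_onD)
    then show ?case
      by (simp add: nfa_run.nfa_run_Nil)
  next
    case (nfa_run_Cons x a z w y)
    from nfa_run_Cons.hyps(1) obtain q' p where p: "(q', a, p) \<in> \<delta>" "x = f q'" "z = f p"
      unfolding \<delta>'_def by auto
    have "q' \<in> Q" "p \<in> Q"
      using p(1) sub by auto
    moreover have "q' = q"
      using p(2) \<open>q' \<in> Q\<close> nfa_run_Cons.prems f by (metis inj_onD)
    ultimately show ?case
      using p nfa_run_Cons.IH nfa_run_Cons.prems by (auto intro: nfa_run.nfa_run_Cons)
  qed
  have eq: "nfa_lang \<delta>' (f q) (f r) = nfa_lang \<delta> q r" if "q \<in> Q" "r \<in> Q" for q r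
    using fwd bwd that unfolding nfa_lang_def by blast
  have "is_nfa (f ` Q) \<delta>'"
    using fin sub unfolding is_nfa_def \<delta>'_def by auto
  moreover have "(\<Union>q\<in>I. \<Union>r\<in>F. nfa_lang \<delta> q r) = (\<Union>x\<in>f ` I. \<Union>y\<in>f ` F. nfa_lang \<delta>' x y)"
    unfolding image_image using eq[OF subsetD[OF I] subsetD[OF F]] by simp
  ultimately show ?thesis
    unfolding regular_lang_def using I F by (metis image_mono)
qed

lemma group_langI:
  fixes G :: "'g monoid"
  assumes "group G" and fin: "finite (carrier G)" and hom: "\<eta> \<in> hom free_monoid G"
    and F: "F \<subseteq> carrier G"
  shows "group_lang (\<eta> -` F)"
proof -
  interpret group G by fact
  obtain f :: "'g \<Rightarrow> nat" where f: "inj_on f (carrier G)"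
    using finite_imp_inj_to_nat_seg[OF fin] by blast
  define g where "g = inv_into (carrier G) f"
  have g: "g (f x) = x" if "x \<in> carrier G" for x
    using f that by (simp add: g_def)
  define H :: "nat monoid" where
    "H = \<lparr>carrier = f ` carrier G, mult = (\<lambda>x y. f (g x \<otimes>\<^bsub>G\<^esub> g y)), one = f \<one>\<^bsub>G\<^esub>\<rparr>"
  have H: "carrier H = f ` carrier G" "\<one>\<^bsub>H\<^esub> = f \<one>\<^bsub>G\<^esub>"
    by (simp_all add: H_def)
  have mult: "f x \<otimes>\<^bsub>H\<^esub> f y = f (x \<otimes>\<^bsub>G\<^esub> y)" if "x \<in> carrier G" "y \<in> carrier G" for x y
    using that by (simp add: H_def g)
  have "group H"
  proof (rule groupI)
    fix x assume "x \<in> carrier H"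
    then obtain z where z: "z \<in> carrier G" "x = f z"
      by (auto simp: H)
    then have "f (inv\<^bsub>G\<^esub> z) \<in> carrier H" "f (inv\<^bsub>G\<^esub> z) \<otimes>\<^bsub>H\<^esub> x = \<one>\<^bsub>H\<^esub>"
      by (simp_all add: H mult)
    then show "\<exists>y\<in>carrier H. y \<otimes>\<^bsub>H\<^esub> x = \<one>\<^bsub>H\<^esub>" by blast
  next
    fix x y assume "x \<in> carrier H" "y \<in> carrier H"
    then show "x \<otimes>\<^bsub>H\<^esub> y \<in> carrier H"
      unfolding H by (elim imageE) (simp add: mult)
  next
    fix x y z assume "x \<in> carrier H" "y \<in> carrier H" "z \<in> carrier H"
    then show "x \<otimes>\<^bsub>H\<^esub> y \<otimes>\<^bsub>H\<^esub> z = x \<otimes>\<^bsub>H\<^esub> (y \<otimes>\<^bsub>H\<^esub> z)"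
      unfolding H by (elim imageE) (simp add: mult m_assoc)
  next
    show "\<one>\<^bsub>H\<^esub> \<in> carrier H"
      by (simp add: H)
  next
    fix x assume "x \<in> carrier H"
    then show "\<one>\<^bsub>H\<^esub> \<otimes>\<^bsub>H\<^esub> x = x"
      unfolding H by (elim imageE) (simp add: mult)
  qed
  moreover have eta: "\<eta> w \<in> carrier G" "\<eta> (v @ w) = \<eta> v \<otimes>\<^bsub>G\<^esub> \<eta> w" for v w
    using hom by (auto simp: hom_def free_monoid_def)
  then have "(f \<circ> \<eta>) \<in> hom free_monoid H"
    by (simp add: hom_def free_monoid_def H mult)
  moreover have "\<eta> -` F = (f \<circ> \<eta>) -` (f ` F)"
    using inj_on_image_mem_iff[OF f eta(1) F] by (simp add: set_eq_iff)
  moreover have "finite (carrier H)" "f ` F \<subseteq> carrier H"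
    using fin F by (simp_all add: H image_mono)
  ultimately show ?thesis
    unfolding group_lang_def by blast
qed

end

theory Submission
  imports Defs "HOL-Algebra.Multiplicative_Group" "HOL-Library.Ramsey"
begin

text \<open>
  Since \<open>tau_plus\<close> is monotone, it suffices that every \<open>S \<subseteq> \<tau>(S)\<close> consists of inseparable quadruples
  and that the set \<open>I\<close> of inseparable quadruples satisfies \<open>I \<subseteq> \<tau>(I)\<close>. A language in \<open>BPol(G\<^sup>+)\<close>
  cannot distinguish words with the same profile, that is, the same marked subwords of bounded length
  whose gaps are recorded up to emptiness and a syntactic congruence \<open>\<sim>\<close> of finitely many languages
  of \<open>G\<close>. The quotient by \<open>\<sim>\<close> is a finite group.

  Let \<open>S \<subseteq> \<tau>(S)\<close>. By induction on \<open>m\<close>, each \<open>(q,r,s,t) \<in> S\<close> admits \<open>m\<close> words \<open>\<sim> \<epsilon>\<close> lying alternately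
  in \<open>L(q,r)\<close> and \<open>L(s,t)\<close>, with increasing profiles: take a run of \<open>B\<^sub>S\<close> from \<open>(q,s,q)\<close> to
  \<open>(r,t,r)\<close> over a word \<open>\<sim> \<epsilon>\<close> and insert \<open>x\<^sup>k d x\<^sup>k\<close> at each \<open>\<epsilon>\<close>-transition, where \<open>x\<close> labels the common
  loop and \<open>d\<close> runs through a chain for the quadruple used; the first component only receives \<open>x\<^sup>k\<close>,
  whose profile is smaller, and thus prolongs the chain by one word. A chain longer than the number
  of templates contains two consecutive words of equal profile.

  Let \<open>(q,r,s,t) \<in> I\<close>, witnessed by \<open>u \<in> L(q,r)\<close> and \<open>v \<in> L(s,t)\<close> of equal profile. By Ramsey's
  theorem, \<open>v\<close> is a bounded word \<open>f\<close> with gaps \<open>g\<^sub>i \<sim> \<epsilon>\<close> inserted at positions guarded on both sides by a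
  word \<open>x\<close> acting as an idempotent on the states. Then \<open>u\<close> is \<open>f\<close> with gaps \<open>u\<^sub>i\<close>, and both can be chosen so that
  \<open>u\<^sub>i\<close> and \<open>g\<^sub>i\<close> have equal profiles. Now \<open>f\<close> labels a run of \<open>B\<^sub>I\<close> from \<open>(s,q,s)\<close> to \<open>(t,r,t)\<close>,
  jumping over the words \<open>x u\<^sub>i x\<close> and \<open>x g\<^sub>i x\<close>.
\<close>

subsection \<open>Word congruences\<close>

text \<open>The congruence is the kernel of \<open>h\<close>. With maps in place of relations,
  congruences are intersected by pairing and no quotient monoid has to be built.\<close>

definition word_congruence :: "('a list \<Rightarrow> 'b) \<Rightarrow> bool" where
  "word_congruence h \<longleftrightarrow>
     (\<forall>u u' v v'. h u = h u' \<longrightarrow> h v = h v' \<longrightarrow> h (u @ v) = h (u' @ v'))"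

lemma word_congruenceD:
  "word_congruence h \<Longrightarrow> h u = h u' \<Longrightarrow> h v = h v' \<Longrightarrow> h (u @ v) = h (u' @ v')"
  unfolding word_congruence_def by blast

lemma finite_range_factor:
  assumes "finite (range h)" and "\<And>x y. h x = h y \<Longrightarrow> f x = f y"
  shows "finite (range f)"
proof -
  have "f x = f (inv_into UNIV h (h x))" for x
    by (rule assms(2)) (simp add: f_inv_into_f)
  then have "range f \<subseteq> (\<lambda>z. f (inv_into UNIV h z)) ` range h"
    by auto
  then show ?thesis
    using assms(1) by (meson finite_imageI finite_subset)
qed

abbreviation word_power :: "'a list \<Rightarrow> nat \<Rightarrow> 'a list" where
  "word_power x n \<equiv> concat (replicate n x)"

lemma word_power_add: "word_power x (m + n) = word_power x m @ word_power x n"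
  by (simp add: replicate_add)

lemma word_power_eq_Nil_iff: "word_power x n = [] \<longleftrightarrow> n = 0 \<or> x = []"
  by (cases n) auto

lemma word_power_congruent_Nil:
  assumes "word_congruence h" and "h x = h []"
  shows "h (word_power x n) = h []"
proof (induction n)
  case (Suc n)
  then show ?case
    using word_congruenceD[OF assms Suc] by simp
qed simp

lemma word_power_mult: "word_power x (m * n) = word_power (word_power x m) n"
  by (induction n) (simp_all add: replicate_add)

subsection \<open>Syntactic congruences of finite sets of group languages\<close>

text \<open>The kernel is the intersection of the syntactic congruences of the languages in
  \<open>F\<close>: a word is sent to the contexts that complete it to a member of some
  \<open>L\<close> in \<open>F\<close>.\<close>

definition syn :: "'a lang set \<Rightarrow> 'a list \<Rightarrow> ('a lang \<times> 'a list \<times> 'a list) set" where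
  "syn F w = {(L, u, v). L \<in> F \<and> u @ w @ v \<in> L}"

lemma syn_eq_iff:
  "syn F x = syn F y \<longleftrightarrow> (\<forall>L\<in>F. \<forall>u v. u @ x @ v \<in> L \<longleftrightarrow> u @ y @ v \<in> L)"
  unfolding syn_def by blast

lemma syn_mono: "F \<subseteq> F' \<Longrightarrow> syn F' x = syn F' y \<Longrightarrow> syn F x = syn F y"
  unfolding syn_eq_iff by blast

lemma syn_memD: "syn F x = syn F y \<Longrightarrow> L \<in> F \<Longrightarrow> x \<in> L \<longleftrightarrow> y \<in> L"
  unfolding syn_eq_iff by (metis append_Nil append_Nil2)

lemma word_congruence_syn: "word_congruence (syn F)"
  unfolding word_congruence_def syn_eq_iff by (metis append.assoc)

text \<open>The kernel of the morphism \<eta> refines the syntactic congruence of \<open>L\<close>,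
  so there are finitely many classes and the order of the group is an exponent.\<close>

lemma group_lang_syn:
  assumes "group_lang L"
  shows "finite (range (syn {L}))" and "\<exists>p>0. \<forall>x. syn {L} (word_power x p) = syn {L} []"
proof -
  obtain G :: "nat monoid" and \<eta> F where G: "group G" "finite (carrier G)"
    and hom: "\<eta> \<in> hom free_monoid G" and L: "L = \<eta> -` F"
    using assms unfolding group_lang_def by blast
  interpret group G by fact
  have eta: "\<eta> w \<in> carrier G" "\<eta> (v @ w) = \<eta> v \<otimes>\<^bsub>G\<^esub> \<eta> w" for v w
    using hom by (auto simp: hom_def free_monoid_def)
  have eta_Nil: "\<eta> [] = \<one>\<^bsub>G\<^esub>"
    using eta[of "[]"] eta(2)[of "[]" "[]"] by (metis append_Nil l_cancel_one')
  have eta_syn: "syn {L} x = syn {L} y" if "\<eta> x = \<eta> y" for x y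
    using that by (simp add: syn_eq_iff L eta)
  have "finite (range \<eta>)"
    using G(2) eta(1) by (meson finite_subset image_subsetI)
  then show "finite (range (syn {L}))"
    using eta_syn by (rule finite_range_factor)
  have pow: "\<eta> (word_power x n) = \<eta> x [^]\<^bsub>G\<^esub> n" for x n
  proof (induction n)
    case (Suc n)
    then show ?case
      using eta(1) by (simp only: replicate_Suc concat.simps eta(2) nat_pow_Suc2)
  qed (simp add: eta_Nil)
  have "syn {L} (word_power x (order G)) = syn {L} []" for x
    by (rule eta_syn) (simp add: pow eta eta_Nil pow_order_eq_1)
  moreover have "order G > 0"
    using G(2) by (simp add: order_gt_0_iff_finite)
  ultimately show "\<exists>p>0. \<forall>x. syn {L} (word_power x p) = syn {L} []"
    by blast
qed

lemma syn_insert_eqI: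
  "syn {L} x = syn {L} y \<Longrightarrow> syn F x = syn F y \<Longrightarrow> syn (insert L F) x = syn (insert L F) y"
  unfolding syn_eq_iff by blast

lemma finite_range_syn:
  assumes "finite F" and "\<And>L. L \<in> F \<Longrightarrow> group_lang L"
  shows "finite (range (syn F))"
  using assms
proof (induction F)
  case (insert L F)
  have "range (\<lambda>w. (syn {L} w, syn F w)) \<subseteq> range (syn {L}) \<times> range (syn F)"
    by auto
  moreover have "finite (range (syn {L}))" "finite (range (syn F))"
    using insert group_lang_syn(1)[of L] by auto
  ultimately have "finite (range (\<lambda>w. (syn {L} w, syn F w)))"
    by (meson finite_SigmaI finite_subset)
  then show ?case
    by (rule finite_range_factor) (rule syn_insert_eqI, simp_all)
qed (simp add: syn_def)

lemma syn_exponent: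
  assumes "finite F" and "\<And>L. L \<in> F \<Longrightarrow> group_lang L"
  shows "\<exists>p>0. \<forall>x. syn F (word_power x p) = syn F []"
  using assms
proof (induction F)
  case empty
  show ?case by (rule exI[of _ 1]) (simp add: syn_def)
next
  case (insert L F)
  obtain p where p: "p > 0" "\<And>x. syn F (word_power x p) = syn F []"
    using insert by auto
  obtain p' where p': "p' > 0" "\<And>x. syn {L} (word_power x p') = syn {L} []"
    using group_lang_syn(2)[of L] insert.prems by auto
  have "syn (insert L F) (word_power x (p * p')) = syn (insert L F) []" for x
  proof (rule syn_insert_eqI)
    show "syn {L} (word_power x (p * p')) = syn {L} []"
      by (simp only: word_power_mult p')
    show "syn F (word_power x (p * p')) = syn F []"
      unfolding word_power_mult
      by (rule word_power_congruent_Nil[OF word_congruence_syn p(2)])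
  qed
  then show ?case
    using p(1) p'(1) by (metis mult_pos_pos)
qed

text \<open>The quotient by \<open>syn F\<close> is a group: some power of \<open>u\<close> is
  congruent to the empty word, so \<open>word_power u n\<close> is an inverse of \<open>u\<close>,
  and multiplying by it removes \<open>u\<close>.\<close>

lemma syn_cancel:
  assumes "finite F" and "\<And>L. L \<in> F \<Longrightarrow> group_lang L" and eq: "syn F (u @ g) = syn F u"
  shows "syn F g = syn F []"
proof -
  obtain p where p: "p > 0" "\<And>x. syn F (word_power x p) = syn F []"
    using syn_exponent[OF assms(1,2)] by blast
  obtain n where n: "p = Suc n"
    using p(1) by (cases p) auto
  have pow: "word_power u p = word_power u n @ u"
    using word_power_add[of n 1 u] by (simp add: n)
  note D = word_congruenceD[OF word_congruence_syn]
  have "syn F g = syn F (word_power u p @ g)"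
    using D[OF p(2)[symmetric], of g g] by simp
  also have "\<dots> = syn F (word_power u n @ u @ g)"
    by (simp only: pow append.assoc)
  also have "\<dots> = syn F (word_power u n @ u)"
    by (rule D[OF refl eq])
  also have "\<dots> = syn F []"
    by (simp only: pow[symmetric] p)
  finally show ?thesis .
qed

subsection \<open>Boolean algebras of languages\<close>

lemma lang_boolean_algebraD:
  assumes "lang_boolean_algebra B"
  shows "{} \<in> B" "UNIV \<in> B" "K \<in> B \<Longrightarrow> L \<in> B \<Longrightarrow> K \<union> L \<in> B" "K \<in> B \<Longrightarrow> L \<in> B \<Longrightarrow> K \<inter> L \<in> B"
    "L \<in> B \<Longrightarrow> - L \<in> B"
  using assms unfolding lang_boolean_algebra_def lang_lattice_def by auto

lemma lang_boolean_algebra_Union: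
  assumes "lang_boolean_algebra B" and "finite M" and "M \<subseteq> B"
  shows "\<Union>M \<in> B"
  using assms(2,3) by induction (auto simp: lang_boolean_algebraD[OF assms(1)])

lemma lang_boolean_algebra_Inter:
  assumes "lang_boolean_algebra B" and "finite M" and "M \<subseteq> B"
  shows "\<Inter>M \<in> B"
  using assms(2,3) by induction (auto simp: lang_boolean_algebraD[OF assms(1)])

text \<open>\<open>K\<close> is a union of atoms of the Boolean algebra generated by
  \<open>M\<close>. An atom is determined by the subset of \<open>M\<close> containing its words,
  which leaves finitely many.\<close>

lemma lang_boolean_algebra_saturated:
  assumes B: "lang_boolean_algebra B" and fin: "finite M" and M: "M \<subseteq> B"
    and sat: "\<And>x y. \<lbrakk>\<And>X. X \<in> M \<Longrightarrow> x \<in> X \<longleftrightarrow> y \<in> X\<rbrakk> \<Longrightarrow> x \<in> K \<Longrightarrow> y \<in> K"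
  shows "K \<in> B"
proof -
  define atom where "atom N = \<Inter>((\<lambda>X. if X \<in> N then X else - X) ` M)" for N
  define trace where "trace x = {X \<in> M. x \<in> X}" for x
  have atom: "y \<in> atom (trace x) \<longleftrightarrow> (\<forall>X\<in>M. x \<in> X \<longleftrightarrow> y \<in> X)" for x y
    unfolding atom_def trace_def by auto
  have "atom N \<in> B" for N
    unfolding atom_def using fin M lang_boolean_algebraD(5)[OF B]
    by (intro lang_boolean_algebra_Inter[OF B]) auto
  moreover have "finite (trace ` K)"
    by (rule finite_subset[of _ "Pow M"]) (auto simp: trace_def fin)
  ultimately have "\<Union>(atom ` trace ` K) \<in> B"
    by (intro lang_boolean_algebra_Union[OF B]) auto
  moreover have "\<Union>(atom ` trace ` K) = K"
    using atom sat by (auto; blast)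
  ultimately show ?thesis by simp
qed

lemma lang_boolean_algebra_BPol: "lang_boolean_algebra (BPol C)"
  unfolding BPol_def lang_boolean_algebra_def lang_lattice_def by auto

lemma Pol_subset_BPol: "Pol C \<subseteq> BPol C"
  unfolding BPol_def by blast

lemma BPol_induct_boolean_algebra:
  "lang_boolean_algebra B \<Longrightarrow> Pol C \<subseteq> B \<Longrightarrow> BPol C \<subseteq> B"
  unfolding BPol_def by blast

text \<open>The two-sided quotients of the languages in \<open>F\<close> lie in \<open>G\<close>,
  and words that agree on all of them are congruent modulo \<open>syn F\<close>.\<close>

lemma syn_saturated_mem:
  assumes G: "group_prevariety G" and F: "finite F" "F \<subseteq> G"
    and sat: "\<And>x y. syn F x = syn F y \<Longrightarrow> x \<in> K \<Longrightarrow> y \<in> K"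
  shows "K \<in> G"
proof -
  define quot where "quot L u v = left_quotient u (right_quotient L v)" for L :: "'a lang" and u v
  define M where "M = {quot L u v | L u v. L \<in> F}"
  have B: "lang_boolean_algebra G" and grp: "\<And>L. L \<in> G \<Longrightarrow> group_lang L"
    and "\<And>L v. L \<in> G \<Longrightarrow> left_quotient v L \<in> G \<and> right_quotient L v \<in> G"
    using G unfolding group_prevariety_def prevariety_def by auto
  then have "M \<subseteq> G"
    using F(2) unfolding M_def quot_def by auto
  have mem: "w \<in> quot L u v \<longleftrightarrow> u @ w @ v \<in> L" for w L u v
    by (simp add: quot_def left_quotient_def right_quotient_def)
  have "finite (range (syn F))"
    using F grp by (intro finite_range_syn) auto
  \<comment> \<open>Each quotient is a union of classes of \<open>syn F\<close>, so the finite index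
    leaves finitely many quotients.\<close>
  then have "finite ((\<lambda>T. syn F -` T) ` Pow (range (syn F)))"
    by simp
  moreover have "M \<subseteq> (\<lambda>T. syn F -` T) ` Pow (range (syn F))"
  proof
    fix X assume "X \<in> M"
    then obtain L u v where X: "X = quot L u v" "L \<in> F"
      unfolding M_def by blast
    have "syn F x = syn F y \<Longrightarrow> x \<in> X \<longleftrightarrow> y \<in> X" for x y
      using X(2) unfolding syn_eq_iff X(1) mem by blast
    then have "X = syn F -` (syn F ` X)"
      by blast
    then show "X \<in> (\<lambda>T. syn F -` T) ` Pow (range (syn F))"
      by blast
  qed
  ultimately have "finite M"
    by (rule rev_finite_subset)
  have eq: "syn F x = syn F y" if "\<And>X. X \<in> M \<Longrightarrow> x \<in> X \<longleftrightarrow> y \<in> X" for x y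
  proof -
    have "u @ x @ v \<in> L \<longleftrightarrow> u @ y @ v \<in> L" if "L \<in> F" for L u v
      using \<open>\<And>X. X \<in> M \<Longrightarrow> x \<in> X \<longleftrightarrow> y \<in> X\<close>[of "quot L u v"] that unfolding mem M_def by blast
    then show ?thesis unfolding syn_eq_iff by blast
  qed
  show ?thesis
    using eq sat by (intro lang_boolean_algebra_saturated[OF B \<open>finite M\<close> \<open>M \<subseteq> G\<close>]) blast
qed

subsection \<open>Templates and profiles\<close>

text \<open>A template is a marked product of classes of \<open>h\<close> with at most \<open>n\<close> marked letters; the
  profile of a word (defined below) is the set of the templates it belongs to.\<close>

inductive tmpl :: "('a list \<Rightarrow> 'b) \<Rightarrow> nat \<Rightarrow> 'a lang \<Rightarrow> bool" for h where
  tmpl_class: "tmpl h n {w. h w = h u}"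
| tmpl_mark: "tmpl h n X \<Longrightarrow> tmpl h (Suc n) {x @ a # y | x y. h x = h u \<and> y \<in> X}"

lemma tmpl_mono: "tmpl h n X \<Longrightarrow> n \<le> m \<Longrightarrow> tmpl h m X"
proof (induction n X arbitrary: m rule: tmpl.induct)
  case (tmpl_class n u)
  show ?case by (rule tmpl.tmpl_class)
next
  case (tmpl_mark n X a u)
  then obtain k where "m = Suc k" "n \<le> k"
    by (cases m) auto
  then show ?case
    by (auto intro: tmpl.tmpl_mark tmpl_mark.IH)
qed

lemma finite_tmpl:
  fixes h :: "('a :: finite) list \<Rightarrow> 'b"
  assumes "finite (range h)"
  shows "finite {X. tmpl h n X}"
proof (induction n)
  case 0
  have "{X. tmpl h 0 X} \<subseteq> (\<lambda>c. {w. h w = c}) ` range h"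
  proof
    fix X assume "X \<in> {X. tmpl h 0 X}"
    then have "tmpl h 0 X"
      by simp
    then show "X \<in> (\<lambda>c. {w. h w = c}) ` range h"
      by cases auto
  qed
  then show ?case
    using assms by (meson finite_imageI finite_subset)
next
  case (Suc n)
  have "{X. tmpl h (Suc n) X} \<subseteq> (\<lambda>c. {w. h w = c}) ` range h \<union>
    (\<lambda>(c, a, X). {x @ a # y | x y. h x = c \<and> y \<in> X}) ` (range h \<times> UNIV \<times> {X. tmpl h n X})"
  proof
    fix X assume "X \<in> {X. tmpl h (Suc n) X}"
    then have "tmpl h (Suc n) X"
      by simp
    then show "X \<in> (\<lambda>c. {w. h w = c}) ` range h \<union>
      (\<lambda>(c, a, X). {x @ a # y | x y. h x = c \<and> y \<in> X}) ` (range h \<times> UNIV \<times> {X. tmpl h n X})"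
    proof cases
      case (tmpl_class u)
      then show ?thesis by blast
    next
      case (tmpl_mark Y a u)
      then have "X = (\<lambda>(c, a, X). {x @ a # y | x y. h x = c \<and> y \<in> X}) (h u, a, Y)"
        and "(h u, a, Y) \<in> range h \<times> UNIV \<times> {X. tmpl h n X}"
        by auto
      then show ?thesis by blast
    qed
  qed
  then show ?case
    using assms Suc by (meson finite_SigmaI finite_UNIV finite_Un finite_imageI finite_subset)
qed

lemma ex_tmpl: "\<exists>X. tmpl h n X \<and> w \<in> X"
  using tmpl_class[of h n w] by blast

text \<open>A template prescribes its letters and the class of each gap. In merging, this makes a
  single class contain every template that it meets.\<close>

lemma tmpl_h_eq:
  assumes "word_congruence h" and "tmpl h n X" and "x \<in> X" "y \<in> X"
  shows "h x = h y"
  using assms(2-4)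
proof (induction n X arbitrary: x y rule: tmpl.induct)
  case (tmpl_mark n X a u)
  then obtain x1 x2 y1 y2 where "x = x1 @ [a] @ x2" "y = y1 @ [a] @ y2" "h x1 = h u" "h y1 = h u"
    "x2 \<in> X" "y2 \<in> X"
    by auto
  then show ?case
    using tmpl_mark.IH word_congruenceD[OF assms(1)] by metis
qed simp

section \<open>Common refinement of templates\<close>

lemma append_Cons_eq_append_Cons:
  assumes "x @ a # y = x' @ b # y'"
  obtains "x = x'" "a = b" "y = y'"
  | t where "x' = x @ a # t" "y = t @ b # y'"
  | t where "x = x' @ b # t" "y' = t @ a # y"
proof -
  from assms obtain us where "x = x' @ us \<and> us @ a # y = b # y' \<or> x @ us = x' \<and> a # y = us @ b # y'"
    unfolding append_eq_append_conv2 by blast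
  then show thesis
    using that by (cases us) auto
qed

text \<open>The marks of the two factorizations of \<open>g\<close> are interleaved from left to
  right. A common first mark serves both templates; otherwise the template marking first is peeled,
  while the other loses a prefix but none of its marks.\<close>

lemma tmpl_merge:
  assumes h: "word_congruence h"
  shows "tmpl h n X \<Longrightarrow> tmpl h m Y \<Longrightarrow> g \<in> X \<Longrightarrow> g \<in> Y \<Longrightarrow>
    \<exists>Z. tmpl h (n + m) Z \<and> g \<in> Z \<and> Z \<subseteq> X \<and> Z \<subseteq> Y"
proof (induction "n + m" arbitrary: n m X Y g rule: less_induct)
  case less
  note D = word_congruenceD[OF h]
  \<comment> \<open>The first mark of \<open>X\<close> lies strictly to the left of that of
    \<open>Y\<close>. The separate bounds \<open>n0\<close> and \<open>m0\<close> allow reuse with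
    the two templates exchanged.\<close>
  have aux: "\<exists>Z. tmpl h (Suc n' + m) Z \<and> x @ a # y \<in> Z \<and> Z \<subseteq> X \<and> Z \<subseteq> Y"
    if X: "X = {x @ a # y | x y. h x = h u \<and> y \<in> X'}" "tmpl h n' X'"
      and Y: "Y = {x @ b # y | x y. h x = h v \<and> y \<in> Y'}" "tmpl h m' Y'" "m = Suc m'"
      and x: "h x = h u" "y \<in> X'" and x': "h (x @ a # t) = h v" "y' \<in> Y'" "y = t @ b # y'"
      and less: "n' + m < n0 + m0" and IH: "\<And>n m X Y g. n + m < n0 + m0 \<Longrightarrow>
        tmpl h n X \<Longrightarrow> tmpl h m Y \<Longrightarrow> g \<in> X \<Longrightarrow> g \<in> Y \<Longrightarrow>
        \<exists>Z. tmpl h (n + m) Z \<and> g \<in> Z \<and> Z \<subseteq> X \<and> Z \<subseteq> Y"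
    for n' m' m n0 m0 :: nat and X Y X' Y' x a y u b v t y'
  proof -
    \<comment> \<open>What remains of \<open>Y\<close> behind the mark \<open>a\<close>: its first
      gap shrinks to the class of \<open>t\<close>.\<close>
    let ?Y = "{x @ b # y | x y. h x = h t \<and> y \<in> Y'}"
    have "tmpl h m ?Y"
      unfolding Y(3) using Y(2) by (rule tmpl.tmpl_mark)
    moreover have "y \<in> ?Y"
      using x' by blast
    ultimately obtain Z where Z: "tmpl h (n' + m) Z" "y \<in> Z" "Z \<subseteq> X'" "Z \<subseteq> ?Y"
      using IH[OF less X(2)] x(2) by blast
    let ?Z = "{x @ a # y | x y. h x = h u \<and> y \<in> Z}"
    have "?Z \<subseteq> Y"
    proof
      fix w assume "w \<in> ?Z"
      then obtain w1 w2 where w: "w = w1 @ a # w2" "h w1 = h u" "w2 \<in> Z" by blast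
      then obtain w3 w4 where w': "w2 = w3 @ b # w4" "h w3 = h t" "w4 \<in> Y'"
        using Z(4) by blast
      have "h (w1 @ [a] @ w3) = h (x @ [a] @ t)"
        by (intro D refl) (simp_all add: w(2) x(1) w'(2))
      then have "h (w1 @ a # w3) = h v"
        using x'(1) by simp
      moreover have "w = (w1 @ a # w3) @ b # w4"
        using w w' by simp
      ultimately show "w \<in> Y"
        using w'(3) unfolding Y(1) by blast
    qed
    moreover have "?Z \<subseteq> X" "x @ a # y \<in> ?Z"
      using X Z x by auto
    moreover have "tmpl h (Suc n' + m) ?Z"
      using tmpl.tmpl_mark[OF Z(1)] by simp
    ultimately show ?thesis by blast
  qed
  show ?case
    using less.prems(1)
  proof cases
    case (tmpl_class u)
    have "w \<in> X" if "w \<in> Y" for w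
      using tmpl_h_eq[OF h less.prems(2) that less.prems(4)] less.prems(3)
      unfolding tmpl_class by simp
    then have "Y \<subseteq> X" by blast
    moreover have "tmpl h (n + m) Y"
      by (rule tmpl_mono[OF less.prems(2)]) simp
    ultimately show ?thesis
      using less.prems(4) by blast
  next
    case mark: (tmpl_mark n' X' a u)
    note X = this
    show ?thesis
      using less.prems(2)
    proof cases
      case (tmpl_class u)
      have "w \<in> Y" if "w \<in> X" for w
        using tmpl_h_eq[OF h less.prems(1) that less.prems(3)] less.prems(4)
        unfolding tmpl_class by simp
      then have "X \<subseteq> Y" by blast
      moreover have "tmpl h (n + m) X"
        by (rule tmpl_mono[OF less.prems(1)]) simp
      ultimately show ?thesis
        using less.prems(3) by blast
    next
      case (tmpl_mark m' Y' b v)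
      obtain x y where g: "g = x @ a # y" "h x = h u" "y \<in> X'"
        using less.prems(3) X by blast
      obtain x' y' where g': "g = x' @ b # y'" "h x' = h v" "y' \<in> Y'"
        using less.prems(4) tmpl_mark by blast
      have "x @ a # y = x' @ b # y'"
        using g g' by simp
      then consider "x = x'" "a = b" "y = y'"
        | t where "x' = x @ a # t" "y = t @ b # y'"
        | t where "x = x' @ b # t" "y' = t @ a # y"
        by (rule append_Cons_eq_append_Cons)
      then show ?thesis
      proof cases
        case 1
        obtain Z where Z: "tmpl h (n' + m') Z" "y \<in> Z" "Z \<subseteq> X'" "Z \<subseteq> Y'"
          using less.hyps[OF _ X(3) tmpl_mark(3) g(3)] g'(3) 1(3) X(1) tmpl_mark(1) by auto
        have "{x @ a # y | x y. h x = h u \<and> y \<in> Z} \<subseteq> X"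
          unfolding X(2) using Z(3) by blast
        moreover have "h u = h v"
          using g(2) g'(2) 1(1) by simp
        then have "{x @ a # y | x y. h x = h u \<and> y \<in> Z} \<subseteq> Y"
          unfolding tmpl_mark(2) 1(2) using Z(4) by auto
        moreover have "g \<in> {x @ a # y | x y. h x = h u \<and> y \<in> Z}"
          using g(1,2) Z(2) by blast
        moreover have "tmpl h (n + m) {x @ a # y | x y. h x = h u \<and> y \<in> Z}"
          using tmpl_mono[OF tmpl.tmpl_mark[OF Z(1)], of "n + m"] X(1) tmpl_mark(1) by simp
        ultimately show ?thesis by blast
      next
        case 2
        have "\<exists>Z. tmpl h (Suc n' + m) Z \<and> x @ a # y \<in> Z \<and> Z \<subseteq> X \<and> Z \<subseteq> Y"
        proof (rule aux[OF X(2,3) tmpl_mark(2,3,1) g(2,3) _ g'(3) 2(2) _ less.hyps])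
          show "h (x @ a # t) = h v" using 2 g' by simp
          show "n' + m < n + m" using X(1) by simp
        qed
        then show ?thesis
          unfolding g(1) X(1) .
      next
        case 3
        have "\<exists>Z. tmpl h (Suc m' + n) Z \<and> x' @ b # y' \<in> Z \<and> Z \<subseteq> Y \<and> Z \<subseteq> X"
        \<comment> \<open>Roles exchanged. Only the sum of the two bounds enters, so it is passed as
          \<open>m + n\<close> and \<open>0\<close>.\<close>
        proof (rule aux[OF tmpl_mark(2,3) X(2,3,1) g'(2,3) _ g(3) 3(2), of "m + n" 0])
          show "h (x' @ b # t) = h u" using 3 g by simp
          show "m' + n < m + n + 0" using tmpl_mark(1) by simp
        qed (rule less.hyps, simp_all)
        then show ?thesis
          unfolding g'(1) tmpl_mark(1)[symmetric] by (metis add.commute)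
      qed
    qed
  qed
qed

section \<open>Profiles and their compatibility with concatenation\<close>

definition profile :: "('a list \<Rightarrow> 'b) \<Rightarrow> nat \<Rightarrow> 'a list \<Rightarrow> 'a lang set" where
  "profile h n w = {X. tmpl h n X \<and> w \<in> X}"

lemma finite_profile:
  fixes h :: "('a :: finite) list \<Rightarrow> 'b"
  shows "finite (range h) \<Longrightarrow> finite (profile h n w)"
  unfolding profile_def by (rule finite_subset[OF _ finite_tmpl]) auto

lemma profile_eqD: "profile h n u \<subseteq> profile h n v \<Longrightarrow> h u = h v"
  unfolding profile_def using tmpl_class[of h n u] by auto

lemma profile_antimono:
  "n \<le> m \<Longrightarrow> profile h m u \<subseteq> profile h m v \<Longrightarrow> profile h n u \<subseteq> profile h n v"
  unfolding profile_def using tmpl_mono by blast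

lemma tmpl_refine:
  assumes "\<And>x y. h' x = h' y \<Longrightarrow> h x = h y" and "tmpl h n X" and "w \<in> X"
  shows "\<exists>X'. tmpl h' n X' \<and> w \<in> X' \<and> X' \<subseteq> X"
  using assms(2,3)
proof (induction n X arbitrary: w rule: tmpl.induct)
  case (tmpl_class n u)
  show ?case
  proof (intro exI conjI subsetI)
    show "tmpl h' n {x. h' x = h' w}" by (rule tmpl.tmpl_class)
    show "w \<in> {x. h' x = h' w}" by simp
    show "x \<in> {w. h w = h u}" if "x \<in> {x. h' x = h' w}" for x
      using that tmpl_class assms(1)[of x w] by simp
  qed
next
  case (tmpl_mark n X a u)
  then obtain x y where w: "w = x @ a # y" "h x = h u" "y \<in> X"
    by blast
  obtain X' where X': "tmpl h' n X'" "y \<in> X'" "X' \<subseteq> X"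
    using tmpl_mark.IH[OF w(3)] by blast
  have "h z = h u" if "h' z = h' x" for z
    using assms(1)[OF that] w(2) by simp
  then have "{z @ a # y | z y. h' z = h' x \<and> y \<in> X'} \<subseteq> {x @ a # y | x y. h x = h u \<and> y \<in> X}"
    using X'(3) by blast
  moreover have "w \<in> {z @ a # y | z y. h' z = h' x \<and> y \<in> X'}"
    using X'(2) w(1) by blast
  ultimately show ?case
    using tmpl.tmpl_mark[OF X'(1), of a x] by blast
qed

lemma profile_refine:
  assumes "\<And>x y. h' x = h' y \<Longrightarrow> h x = h y" and "profile h' n u \<subseteq> profile h' n v"
  shows "profile h n u \<subseteq> profile h n v"
proof
  fix X assume "X \<in> profile h n u"
  then have "tmpl h n X" "u \<in> X"
    by (auto simp: profile_def)
  then have "\<exists>X'. tmpl h' n X' \<and> u \<in> X' \<and> X' \<subseteq> X"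
    by (intro tmpl_refine[of h' h] assms(1))
  then obtain X' where "tmpl h' n X'" "u \<in> X'" "X' \<subseteq> X"
    by blast
  then have "v \<in> X"
    using assms(2) by (auto simp: profile_def)
  with \<open>tmpl h n X\<close> show "X \<in> profile h n v"
    by (simp add: profile_def)
qed

text \<open>The cut between \<open>u\<close> and \<open>u'\<close> falls into one gap, whose class
  is split in two, and the marks are distributed to the two sides. This makes inclusion of profiles
  compatible with concatenation.\<close>

lemma tmpl_split:
  assumes h: "word_congruence h" and "tmpl h n X" and "u @ u' \<in> X"
  shows "\<exists>Y Z. tmpl h n Y \<and> tmpl h n Z \<and> u \<in> Y \<and> u' \<in> Z \<and> (\<forall>y\<in>Y. \<forall>z\<in>Z. y @ z \<in> X)"
  using assms(2,3)
proof (induction n X arbitrary: u u' rule: tmpl.induct)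
  case (tmpl_class n v)
  show ?case
  proof (intro exI conjI ballI)
    show "tmpl h n {w. h w = h u}" "tmpl h n {w. h w = h u'}"
      by (rule tmpl.tmpl_class)+
    show "y @ z \<in> {w. h w = h v}" if "y \<in> {w. h w = h u}" "z \<in> {w. h w = h u'}" for y z
      using that tmpl_class word_congruenceD[OF h, of y u z u'] by simp
  qed simp_all
next
  case (tmpl_mark n X a v)
  then obtain x y where eq: "u @ u' = x @ a # y" and x: "h x = h v" and y: "y \<in> X"
    by blast
  consider t where "x = u @ t" "u' = t @ a # y" | t where "u = x @ a # t" "y = t @ u'"
    using eq by (auto simp: append_eq_append_conv2 append_eq_Cons_conv)
  then show ?case
  proof cases
    case 1
    have "y1 @ y2 @ a # z \<in> {x @ a # y | x y. h x = h v \<and> y \<in> X}"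
      if "h y1 = h u" "h y2 = h t" "z \<in> X" for y1 y2 z
    proof -
      have "h (y1 @ y2) = h v"
        using word_congruenceD[OF h that(1,2)] x 1 by simp
      with that(3) have "\<exists>x y. (y1 @ y2) @ a # z = x @ a # y \<and> h x = h v \<and> y \<in> X"
        by blast
      then show ?thesis by simp
    qed
    moreover have "u' \<in> {x @ a # y | x y. h x = h t \<and> y \<in> X}"
      using 1 y by blast
    moreover have "u \<in> {w. h w = h u}"
      by simp
    ultimately show ?thesis
      using tmpl.tmpl_class[of h "Suc n" u] tmpl.tmpl_mark[OF tmpl_mark.hyps, of a t] by blast
  next
    case 2
    obtain Y Z where YZ: "tmpl h n Y" "tmpl h n Z" "t \<in> Y" "u' \<in> Z" "\<forall>y\<in>Y. \<forall>z\<in>Z. y @ z \<in> X"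
      using tmpl_mark.IH[of t u'] 2 y by blast
    have "u \<in> {x @ a # y | x y. h x = h v \<and> y \<in> Y}"
      using 2 x YZ(3) by blast
    moreover have "y @ z \<in> {x @ a # y | x y. h x = h v \<and> y \<in> X}"
      if "y \<in> {x @ a # y | x y. h x = h v \<and> y \<in> Y}" "z \<in> Z" for y z
    proof -
      from that(1) obtain y1 y2 where "y = y1 @ a # y2" "h y1 = h v" "y2 \<in> Y"
        by blast
      moreover have "y2 @ z \<in> X"
        using \<open>y2 \<in> Y\<close> that(2) YZ(5) by blast
      ultimately show ?thesis by auto
    qed
    moreover have "tmpl h (Suc n) Z"
      by (rule tmpl_mono[OF YZ(2)]) simp
    ultimately show ?thesis
      using tmpl.tmpl_mark[OF YZ(1), of a v] YZ(4) by blast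
  qed
qed

lemma profile_append_mono:
  assumes h: "word_congruence h"
    and "profile h n u \<subseteq> profile h n v" and "profile h n u' \<subseteq> profile h n v'"
  shows "profile h n (u @ u') \<subseteq> profile h n (v @ v')"
proof
  fix X assume X: "X \<in> profile h n (u @ u')"
  then obtain Y Z where "tmpl h n Y" "tmpl h n Z" "u \<in> Y" "u' \<in> Z" and *: "\<forall>y\<in>Y. \<forall>z\<in>Z. y @ z \<in> X"
    using tmpl_split[OF h, of n X u u'] by (auto simp: profile_def)
  then have "v \<in> Y" "v' \<in> Z"
    using assms(2,3) by (auto simp: profile_def)
  then show "X \<in> profile h n (v @ v')"
    using * X by (auto simp: profile_def)
qed

text \<open>Merging all templates in the profile of \<open>g\<close> gives one template that forces
  each of them. There are at most \<open>card T\<close> of them with \<open>k\<close> marks each, a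
  bound independent of \<open>g\<close>.\<close>

lemma tmpl_cover:
  fixes h :: "('a :: finite) list \<Rightarrow> 'b"
  assumes h: "word_congruence h" and fin: "finite (range h)"
  shows "\<exists>N. \<forall>g. \<exists>P. tmpl h N P \<and> g \<in> P \<and> (\<forall>w\<in>P. profile h k g \<subseteq> profile h k w)"
proof -
  define T where "T = {X. tmpl h k X}"
  have T: "finite T"
    unfolding T_def using fin by (rule finite_tmpl)
  have aux: "\<exists>P. tmpl h (card M * k) P \<and> g \<in> P \<and> (\<forall>X\<in>M. P \<subseteq> X)"
    if "finite M" and "M \<subseteq> profile h k g" for g M
    using that
  proof induction
    case empty
    show ?case using ex_tmpl[of h _ g] by auto
  next
    case (insert X M)
    then obtain P where P: "tmpl h (card M * k) P" "g \<in> P" "\<forall>X\<in>M. P \<subseteq> X"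
      by auto
    have X: "tmpl h k X" "g \<in> X"
      using insert.prems by (auto simp: profile_def)
    obtain Z where "tmpl h (k + card M * k) Z" "g \<in> Z" "Z \<subseteq> X" "Z \<subseteq> P"
      using tmpl_merge[OF h X(1) P(1) X(2) P(2)] by blast
    then show ?case
      using P(3) insert.hyps by (intro exI[of _ Z]) auto
  qed
  have "\<exists>P. tmpl h (card T * k) P \<and> g \<in> P \<and> (\<forall>w\<in>P. profile h k g \<subseteq> profile h k w)" for g
  proof -
    have "profile h k g \<subseteq> T"
      by (auto simp: profile_def T_def)
    then have le: "card (profile h k g) * k \<le> card T * k"
      using T by (simp add: card_mono)
    obtain P where P: "tmpl h (card (profile h k g) * k) P" "g \<in> P" "\<forall>X\<in>profile h k g. P \<subseteq> X"
      using aux[OF finite_profile[OF fin] order_refl] by blast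
    have "profile h k g \<subseteq> profile h k w" if "w \<in> P" for w
      using P(3) that by (auto simp: profile_def)
    then show ?thesis
      using tmpl_mono[OF P(1) le] P(2) by blast
  qed
  then show ?thesis by blast
qed

subsection \<open>Guarded decompositions\<close>

text \<open>Each pair in \<open>ps\<close> holds the left and right context of one gap, and
  \<open>z\<close> is the remaining word. Once either list is exhausted, the word ends with
  \<open>z\<close>.\<close>

fun fill :: "('a list \<times> 'a list) list \<Rightarrow> 'a list list \<Rightarrow> 'a list \<Rightarrow> 'a list" where
  "fill ((l, r) # ps) (g # gs) z = l @ g @ r @ fill ps gs z"
| "fill _ _ z = z"

text \<open>The number of marks that suffice when every letter outside the gaps is marked and each
  gap is described by a template with bound \<open>N\<close>.\<close>

definition fill_cost :: "nat \<Rightarrow> ('a list \<times> 'a list) list \<Rightarrow> 'a list \<Rightarrow> nat" where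
  "fill_cost N ps z = length z + (\<Sum>(l, r)\<leftarrow>ps. length l + length r + N)"

text \<open>An idempotent class absorbed by both contexts: copies of \<open>x\<close> may be
  inserted next to the gap without changing the classes of \<open>l\<close> and
  \<open>r\<close>.\<close>

definition guarded :: "('a list \<Rightarrow> 'b) \<Rightarrow> 'a list \<Rightarrow> 'a list \<Rightarrow> bool" where
  "guarded \<alpha> l r \<longleftrightarrow> (\<exists>x. x \<noteq> [] \<and> \<alpha> (x @ x) = \<alpha> x \<and> \<alpha> (l @ x) = \<alpha> l \<and> \<alpha> (x @ r) = \<alpha> r)"

text \<open>Ramsey's theorem for the colouring of pairs of positions by the class of the factor
  between them. A monochromatic triple gives adjacent factors \<open>x\<close> and \<open>y\<close>
  whose classes agree with that of \<open>x @ y\<close>.\<close>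

lemma ex_idempotent_factors:
  assumes fin: "finite (range \<alpha>)"
  shows "\<exists>N. \<forall>w. N \<le> length w \<longrightarrow> (\<exists>p x y s. w = p @ x @ y @ s \<and> x \<noteq> [] \<and> y \<noteq> [] \<and>
    length (p @ x @ y) \<le> N \<and> \<alpha> x = \<alpha> y \<and> \<alpha> (x @ y) = \<alpha> x)"
proof -
  obtain c where c: "bij_betw c (range \<alpha>) {0..<card (range \<alpha>)}"
    using ex_bij_betw_finite_nat[OF fin] by blast
  define C where "C = card (range \<alpha>)"
  have c_less: "c (\<alpha> w) < C" for w
    using bij_betwE[OF c] by (auto simp: C_def)
  have c_inj: "c (\<alpha> v) = c (\<alpha> w) \<longleftrightarrow> \<alpha> v = \<alpha> w" for v w
    using bij_betw_imp_inj_on[OF c] by (auto simp: inj_on_def)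
  obtain N :: nat where N: "partn_lst {..<N} (replicate C 3) 2"
    using ramsey_full by blast
  have "\<exists>p x y s. w = p @ x @ y @ s \<and> x \<noteq> [] \<and> y \<noteq> [] \<and>
    length (p @ x @ y) \<le> N \<and> \<alpha> x = \<alpha> y \<and> \<alpha> (x @ y) = \<alpha> x" if w: "N \<le> length w" for w
  proof -
    define factor where "factor i j = take (j - i) (drop i w)" for i j
    define f where "f e = c (\<alpha> (factor (Min e) (Max e)))" for e
    obtain i H where iH: "i < C" "H \<in> nsets {..<N} (replicate C 3 ! i)" "f ` nsets H 2 \<subseteq> {i}"
      by (rule partn_lstE[OF N, of f C]) (auto simp: f_def c_less)
    then have "H \<in> nsets {..<N} 3"
      by simp
    then obtain a b d where H: "H = {a, b, d}" "a < b" "b < d" "d < N"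
      unfolding ordered_nsets_3_eq by auto
    have f_eq: "f e = i" if "e \<in> nsets H 2" for e
      using iH(3) that by blast
    have "f {a, b} = i" "f {b, d} = i" "f {a, d} = i"
      using H(2,3) by (intro f_eq; simp add: nsets_def H(1))+
    then have "\<alpha> (factor a b) = \<alpha> (factor b d)" "\<alpha> (factor a d) = \<alpha> (factor a b)"
      using H(2,3) by (auto simp: f_def c_inj simp flip: c_inj)
    moreover have "factor a d = factor a b @ factor b d"
    proof -
      have "factor a d = take (b - a) (drop a w) @ take (d - b) (drop (b - a) (drop a w))"
        unfolding factor_def using H(2,3) take_add[of "b - a" "d - b" "drop a w"] by simp
      then show ?thesis
        using H(2) by (simp add: factor_def)
    qed
    moreover have "w = take a w @ factor a d @ drop d w"
    proof -
      have "factor a d @ drop d w = drop a w"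
        unfolding factor_def using H(2,3) append_take_drop_id[of "d - a" "drop a w"] by simp
      then show ?thesis by simp
    qed
    moreover have "length (factor a b) = b - a" "length (factor b d) = d - b"
      using H(2-4) w by (simp_all add: factor_def)
    ultimately show ?thesis
      using H(2-4) w
      by (intro exI[of _ "take a w"] exI[of _ "factor a b"] exI[of _ "factor b d"]
          exI[of _ "drop d w"]) auto
  qed
  then show ?thesis by blast
qed

text \<open>A cut of a word is described by the class of the prefix before it and the idempotent after it.
  Repeatedly jumping from the first cut of some type to the last cut of the same type removes
  everything but boundedly many letters.\<close>

lemma guarded_decomposition:
  assumes \<alpha>: "word_congruence \<alpha>" and fin: "finite (range \<alpha>)"
  shows "\<exists>n. \<forall>v. \<exists>ps gs z. v = fill ps gs z \<and> length gs = length ps \<and>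
    (\<forall>(l, r)\<in>set ps. r \<noteq> [] \<and> guarded \<alpha> l r) \<and> (\<forall>g\<in>set gs. \<exists>u. \<alpha> (u @ g) = \<alpha> u) \<and>
    \<alpha> (fill ps (map (\<lambda>_. []) ps) z) = \<alpha> v \<and> fill_cost M ps z \<le> n"
proof -
  obtain N where N: "\<And>w. N \<le> length w \<Longrightarrow> \<exists>p x y s. w = p @ x @ y @ s \<and> x \<noteq> [] \<and> y \<noteq> [] \<and>
    length (p @ x @ y) \<le> N \<and> \<alpha> x = \<alpha> y \<and> \<alpha> (x @ y) = \<alpha> x"
    using ex_idempotent_factors[OF fin] by blast
  note D = word_congruenceD[OF \<alpha>]
  \<comment> \<open>\<open>P\<close> is the part of the word already processed. A cut splits the
    rest \<open>y\<close> before a short factor \<open>x\<close> with idempotent class; its type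
    consists of the class \<open>m\<close> of everything before it and the class \<open>e\<close> of
    \<open>x\<close>.\<close>
  define cut where "cut P y m e y' x y'' \<longleftrightarrow> y = y' @ x @ y'' \<and> x \<noteq> [] \<and> length x \<le> N \<and>
    \<alpha> (x @ x) = \<alpha> x \<and> \<alpha> x = e \<and> \<alpha> (P @ y') = m" for P y m e y' x y''
  \<comment> \<open>The types still occurring in \<open>y\<close>; their number is the induction
    measure.\<close>
  define T where "T P y = {(m, e). \<exists>y' x y''. cut P y m e y' x y''}" for P y
  have T_fin: "finite (T P y)" for P y
    by (rule finite_subset[of _ "range \<alpha> \<times> range \<alpha>"]) (auto simp: T_def cut_def fin)
  have main: "\<exists>ps gs z. y = fill ps gs z \<and> length gs = length ps \<and>
    (\<forall>(l, r)\<in>set ps. r \<noteq> [] \<and> guarded \<alpha> l r) \<and> (\<forall>g\<in>set gs. \<exists>u. \<alpha> (u @ g) = \<alpha> u) \<and>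
    \<alpha> (P @ fill ps (map (\<lambda>_. []) ps) z) = \<alpha> (P @ y) \<and>
    fill_cost M ps z \<le> N + card (T P y) * (2 * N + M)" for P y
  proof (induction "card (T P y)" arbitrary: P y rule: less_induct)
    case less
    show ?case
    proof (cases "N \<le> length y")
      case False
      then show ?thesis
        by (intro exI[of _ "[]"] exI[of _ y]) (simp add: fill_cost_def)
    next
      case True
      then obtain p x1 x2 s where y: "y = p @ x1 @ x2 @ s" "x1 \<noteq> []" "x2 \<noteq> []"
        "length (p @ x1 @ x2) \<le> N" "\<alpha> x1 = \<alpha> x2" "\<alpha> (x1 @ x2) = \<alpha> x1"
        using N by blast
      define l where "l = p @ x1"
      have x1: "\<alpha> (x1 @ x1) = \<alpha> x1" and x2: "\<alpha> (x2 @ x2) = \<alpha> x2"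
        using D[of x1 x1 x1 x2] D[of x2 x1 x2 x2] y(5,6) by simp_all
      define m where "m = \<alpha> (P @ l)"
      define e where "e = \<alpha> x1"
      \<comment> \<open>\<open>l\<close> ends with \<open>x1\<close>, so it absorbs the class
        \<open>e\<close>, and it is followed by \<open>x2\<close>, which has the same class.\<close>
      have cut_l: "cut P y m e l x2 s"
        using y x2 by (simp add: cut_def l_def m_def e_def)
      have "length y' < Suc (length y)" if "cut P y m e y' x y''" for y' x y''
        using that by (simp add: cut_def)
      \<comment> \<open>The last cut of the same type; the word between the two cuts becomes the gap
        \<open>g\<close>.\<close>
      then obtain y' where y': "\<exists>x y''. cut P y m e y' x y''"
        and max: "\<And>y1. \<exists>x y''. cut P y m e y1 x y'' \<Longrightarrow> length y1 \<le> length y'"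
        using ex_has_greatest_nat[of "\<lambda>y'. \<exists>x y''. cut P y m e y' x y''" l length "Suc (length y)"]
          cut_l by blast
      obtain x y'' where x: "cut P y m e y' x y''"
        using y' by blast
      have "length l \<le> length y'"
        using max cut_l by blast
      moreover have "l @ x2 @ s = y' @ x @ y''"
        using cut_l x by (simp add: cut_def)
      ultimately obtain g where g: "y' = l @ g"
        by (auto simp: append_eq_append_conv2)
      define P' where "P' = P @ l @ g @ x"
      have y_eq: "y = l @ g @ x @ y''" and x_props: "x \<noteq> []" "length x \<le> N" "\<alpha> x = e"
        and m_eq: "\<alpha> (P @ l @ g) = m"
        using x by (simp_all add: cut_def g)
      have cut_mono: "cut P y m0 e0 (l @ g @ x @ z') x0 z''" if "cut P' y'' m0 e0 z' x0 z''"
        for m0 e0 z' x0 z''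
        using that y_eq by (simp add: cut_def P'_def)
      have "T P' y'' \<subseteq> T P y"
        using cut_mono unfolding T_def by blast
      moreover have "(m, e) \<in> T P y"
        using cut_l unfolding T_def by blast
      \<comment> \<open>As \<open>x\<close> is nonempty, a further cut of this type would come after
        the last one, so the type is used up.\<close>
      moreover have "(m, e) \<notin> T P' y''"
      proof
        assume "(m, e) \<in> T P' y''"
        then obtain z' where "length (l @ g @ x @ z') \<le> length y'"
          using cut_mono max unfolding T_def by blast
        then show False
          using x_props(1) by (simp add: g)
      qed
      ultimately have card: "card (T P' y'') < card (T P y)"
        by (intro psubset_card_mono T_fin) auto
      obtain ps gs z where IH: "y'' = fill ps gs z" "length gs = length ps"
        "\<forall>(l, r)\<in>set ps. r \<noteq> [] \<and> guarded \<alpha> l r" "\<forall>g\<in>set gs. \<exists>u. \<alpha> (u @ g) = \<alpha> u"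
        "\<alpha> (P' @ fill ps (map (\<lambda>_. []) ps) z) = \<alpha> (P' @ y'')"
        "fill_cost M ps z \<le> N + card (T P' y'') * (2 * N + M)"
        using less[OF card] by blast
      have "\<alpha> (l @ x1) = \<alpha> l"
        using D[of p p "x1 @ x1" x1] x1 by (simp add: l_def)
      moreover have "\<alpha> (x1 @ x) = \<alpha> x"
        using D[of x1 x1 x x1] x1 x_props(3) by (simp add: e_def)
      ultimately have "guarded \<alpha> l x"
        using y(2) x1 unfolding guarded_def by blast
      \<comment> \<open>Dropping the gap preserves the class of the prefix. Cancellation in the
        group later turns this equation into neutrality of \<open>g\<close>.\<close>
      have Pl: "\<alpha> (P @ l @ g) = \<alpha> (P @ l)"
        using m_eq by (simp add: m_def)
      then have "\<exists>u. \<alpha> (u @ g) = \<alpha> u"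
        by (metis append.assoc)
      have "\<alpha> (P @ l @ x @ fill ps (map (\<lambda>_. []) ps) z) = \<alpha> (P @ y)"
        using D[OF Pl[symmetric] refl, of "x @ fill ps (map (\<lambda>_. []) ps) z"] IH(5)
        by (simp add: P'_def y_eq)
      have cost: "fill_cost M ((l, x) # ps) z \<le> N + card (T P y) * (2 * N + M)"
      proof -
        have "length l \<le> N"
          using y(4) by (simp add: l_def)
        then have "fill_cost M ((l, x) # ps) z \<le> (2 * N + M) + (N + card (T P' y'') * (2 * N + M))"
          using IH(6) x_props(2) by (simp add: fill_cost_def)
        also have "\<dots> = N + Suc (card (T P' y'')) * (2 * N + M)"
          by simp
        also have "\<dots> \<le> N + card (T P y) * (2 * N + M)"
          using card by (intro add_left_mono mult_le_mono1) simp
        finally show ?thesis .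
      qed
      show ?thesis
      proof (intro exI conjI)
        show "y = fill ((l, x) # ps) (g # gs) z"
          using IH(1) y_eq by simp
        show "length (g # gs) = length ((l, x) # ps)"
          using IH(2) by simp
        show "\<forall>(l, r)\<in>set ((l, x) # ps). r \<noteq> [] \<and> guarded \<alpha> l r"
          using IH(3) x_props(1) \<open>guarded \<alpha> l x\<close> by simp
        show "\<forall>g\<in>set (g # gs). \<exists>u. \<alpha> (u @ g) = \<alpha> u"
          using IH(4) \<open>\<exists>u. \<alpha> (u @ g) = \<alpha> u\<close> by (metis set_ConsD)
        show "\<alpha> (P @ fill ((l, x) # ps) (map (\<lambda>_. []) ((l, x) # ps)) z) = \<alpha> (P @ y)"
          using \<open>\<alpha> (P @ l @ x @ fill ps (map (\<lambda>_. []) ps) z) = \<alpha> (P @ y)\<close>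
          by (simp only: list.map fill.simps append_Nil)
        show "fill_cost M ((l, x) # ps) z \<le> N + card (T P y) * (2 * N + M)"
          by (rule cost)
      qed
    qed
  qed
  have "card (T P y) \<le> card (range \<alpha> \<times> range \<alpha>)" for P y
    by (rule card_mono) (auto simp: T_def cut_def fin)
  then have bound: "N + card (T P y) * (2 * N + M) \<le> N + card (range \<alpha> \<times> range \<alpha>) * (2 * N + M)"
    for P y
    by (intro add_left_mono mult_le_mono1)
  show ?thesis
  proof (rule exI, rule allI)
    fix v
    obtain ps gs z where "v = fill ps gs z" "length gs = length ps"
      "\<forall>(l, r)\<in>set ps. r \<noteq> [] \<and> guarded \<alpha> l r" "\<forall>g\<in>set gs. \<exists>u. \<alpha> (u @ g) = \<alpha> u"
      "\<alpha> (fill ps (map (\<lambda>_. []) ps) z) = \<alpha> v"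
      "fill_cost M ps z \<le> N + card (T [] v) * (2 * N + M)"
      using main[of v "[]"] unfolding append_Nil by blast
    then show "\<exists>ps gs z. v = fill ps gs z \<and> length gs = length ps \<and>
      (\<forall>(l, r)\<in>set ps. r \<noteq> [] \<and> guarded \<alpha> l r) \<and> (\<forall>g\<in>set gs. \<exists>u. \<alpha> (u @ g) = \<alpha> u) \<and>
      \<alpha> (fill ps (map (\<lambda>_. []) ps) z) = \<alpha> v \<and>
      fill_cost M ps z \<le> N + card (range \<alpha> \<times> range \<alpha>) * (2 * N + M)"
      using order_trans[OF _ bound[of "[]" v]] by blast
  qed
qed

subsection \<open>Transferring decompositions between words of equal profile\<close>

text \<open>Since only the empty word has the class of \<open>[]\<close>, a mark behind such a gap
  spells out a letter exactly.\<close>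

lemma tmpl_append_left:
  assumes "\<forall>w. h w = h [] \<longrightarrow> w = []" and X: "tmpl h n X"
  shows "tmpl h (length l + n) ((@) l ` X)"
proof (induction l)
  case (Cons a l)
  have "(@) (a # l) ` X = {x @ a # y | x y. h x = h [] \<and> y \<in> (@) l ` X}"
    using assms(1) by fastforce
  then show ?case
    using tmpl_mark[OF Cons, of a "[]"] by simp
qed (simp add: X)

lemma tmpl_word:
  assumes "\<forall>w. h w = h [] \<longrightarrow> w = []"
  shows "tmpl h (length z) {z}"
proof -
  have "{w. h w = h []} = {[]}"
    using assms by blast
  then show ?thesis
    using tmpl_append_left[OF assms tmpl_class[of h 0 "[]"], of z] by simp
qed

lemma tmpl_marked_concat:
  assumes "tmpl h n X" and Y: "tmpl h m Y"
  shows "tmpl h (Suc (n + m)) {x @ a # y | x y. x \<in> X \<and> y \<in> Y}"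
  using assms(1)
proof (induction n X rule: tmpl.induct)
  case (tmpl_class n u)
  have "tmpl h (n + m) Y"
    by (rule tmpl_mono[OF Y]) simp
  then show ?case
    using tmpl_mark[of h "n + m" Y a u] by simp
next
  case (tmpl_mark n X b u)
  have "{x @ a # y | x y. x \<in> {x @ b # y | x y. h x = h u \<and> y \<in> X} \<and> y \<in> Y} =
    {x @ b # y | x y. h x = h u \<and> y \<in> {x @ a # y | x y. x \<in> X \<and> y \<in> Y}}"
    by (auto; metis append_Cons append.assoc)
  then show ?case
    using tmpl.tmpl_mark[OF tmpl_mark.IH, of b u] by simp
qed

text \<open>All letters outside the gaps become marks. The first letter of each nonempty right
  context is the mark that closes the template of its gap.\<close>

lemma tmpl_fill:
  assumes h: "\<forall>w. h w = h [] \<longrightarrow> w = []"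
    and N: "\<forall>g. \<exists>P. tmpl h N P \<and> g \<in> P \<and> (\<forall>w\<in>P. profile h k g \<subseteq> profile h k w)"
    and "length gs = length ps" and "\<forall>(l, r)\<in>set ps. r \<noteq> []"
  shows "\<exists>P. tmpl h (fill_cost N ps z) P \<and> fill ps gs z \<in> P \<and> (\<forall>w\<in>P. \<exists>us. w = fill ps us z \<and>
    list_all2 (\<lambda>g u. profile h k g \<subseteq> profile h k u) gs us)"
  using assms(3,4)
proof (induction gs ps rule: list_induct2)
  case Nil
  show ?case
    by (rule exI[of _ "{z}"]) (use tmpl_word[OF h, of z] in \<open>simp add: fill_cost_def\<close>)
next
  case (Cons g gs p ps)
  obtain l a r where p: "p = (l, a # r)"
    using Cons.prems by (cases p) (auto simp: neq_Nil_conv)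
  obtain X where X: "tmpl h (fill_cost N ps z) X" "fill ps gs z \<in> X" "\<forall>w\<in>X. \<exists>us. w = fill ps us z \<and>
    list_all2 (\<lambda>g u. profile h k g \<subseteq> profile h k u) gs us"
    using Cons by auto
  obtain P where P: "tmpl h N P" "g \<in> P" "\<forall>w\<in>P. profile h k g \<subseteq> profile h k w"
    using N by blast
  define Z where "Z = (@) l ` {x @ a # y | x y. x \<in> P \<and> y \<in> (@) r ` X}"
  have "tmpl h (length l + Suc (N + (length r + fill_cost N ps z))) Z"
    unfolding Z_def by (intro tmpl_append_left[OF h] tmpl_marked_concat P(1) X(1))
  then have "tmpl h (fill_cost N (p # ps) z) Z"
    by (simp add: fill_cost_def p algebra_simps)
  moreover have "fill (p # ps) (g # gs) z \<in> Z"
    using P(2) X(2) by (auto simp: Z_def p)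
  moreover have "\<exists>us. w = fill (p # ps) us z \<and>
    list_all2 (\<lambda>g u. profile h k g \<subseteq> profile h k u) (g # gs) us" if w: "w \<in> Z" for w
  proof -
    obtain x y where xy: "w = l @ x @ a # r @ y" "x \<in> P" "y \<in> X"
      using w by (auto simp: Z_def)
    then obtain us where "y = fill ps us z" "list_all2 (\<lambda>g u. profile h k g \<subseteq> profile h k u) gs us"
      using X(3) by blast
    then show ?thesis
      using xy P(3) by (intro exI[of _ "x # us"]) (simp add: p)
  qed
  ultimately show ?case by blast
qed

lemma fill_transfer_le:
  assumes h: "\<forall>w. h w = h [] \<longrightarrow> w = []"
    and N: "\<forall>g. \<exists>P. tmpl h N P \<and> g \<in> P \<and> (\<forall>w\<in>P. profile h k g \<subseteq> profile h k w)"
    and "length gs = length ps" and "\<forall>(l, r)\<in>set ps. r \<noteq> []" and n: "fill_cost N ps z \<le> n"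
    and le: "profile h n (fill ps gs z) \<subseteq> profile h n u"
  shows "\<exists>us. u = fill ps us z \<and> list_all2 (\<lambda>g u. profile h k g \<subseteq> profile h k u) gs us"
proof -
  obtain P where P: "tmpl h (fill_cost N ps z) P" "fill ps gs z \<in> P"
    "\<forall>w\<in>P. \<exists>us. w = fill ps us z \<and> list_all2 (\<lambda>g u. profile h k g \<subseteq> profile h k u) gs us"
    using tmpl_fill[OF assms(1-4), of z] by blast
  have "P \<in> profile h n (fill ps gs z)"
    using P(2) tmpl_mono[OF P(1) n] by (simp add: profile_def)
  then have "u \<in> P"
    using le by (auto simp: profile_def)
  then show ?thesis
    using P(3) by blast
qed

text \<open>Going back and forth between the two words, the profiles of the gaps can only grow, so they
  eventually agree.\<close>

lemma fill_transfer:
  fixes h :: "('a :: finite) list \<Rightarrow> 'b"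
  assumes fin: "finite (range h)" and h: "\<forall>w. h w = h [] \<longrightarrow> w = []"
    and N: "\<forall>g. \<exists>P. tmpl h N P \<and> g \<in> P \<and> (\<forall>w\<in>P. profile h k g \<subseteq> profile h k w)"
    and ps: "\<forall>(l, r)\<in>set ps. r \<noteq> []" and n: "fill_cost N ps z \<le> n"
    and eq: "profile h n u = profile h n v" and v: "v = fill ps gs z" "length gs = length ps"
  shows "\<exists>us gs'. u = fill ps us z \<and> v = fill ps gs' z \<and>
    list_all2 (\<lambda>x y. profile h k x = profile h k y) us gs' \<and> length gs' = length ps \<and> map h gs' = map h gs"
proof -
  \<comment> \<open>A potential counting templates over all gaps. It never decreases along the
    transfers, it is bounded, and its stagnation means equal profiles gap by gap.\<close>
  define \<Phi> where "\<Phi> gs = (\<Sum>g\<leftarrow>gs. card (profile h k g))" for gs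
  define C where "C = card {X. tmpl h k X}"
  have "card (profile h k g) \<le> C" for g
    unfolding C_def by (rule card_mono[OF finite_tmpl[OF fin]]) (auto simp: profile_def)
  then have bound: "\<Phi> gs \<le> length gs * C" for gs
    unfolding \<Phi>_def by (induction gs) (auto intro: add_mono)
  have \<Phi>_mono: "\<Phi> gs \<le> \<Phi> us \<and> map h us = map h gs \<and>
    (\<Phi> us = \<Phi> gs \<longrightarrow> list_all2 (\<lambda>x y. profile h k x = profile h k y) us gs)"
    if "list_all2 (\<lambda>g u. profile h k g \<subseteq> profile h k u) gs us" for gs us
    using that
  proof (induction rule: list_all2_induct)
    case (Cons g gs u us)
    have fin': "finite (profile h k u)"
      by (rule finite_profile[OF fin])
    have "card (profile h k g) \<le> card (profile h k u)"
      using Cons.hyps(1) by (rule card_mono[OF fin'])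
    moreover have "profile h k g = profile h k u" if "card (profile h k u) = card (profile h k g)"
      using card_subset_eq[OF fin' Cons.hyps(1)] that by simp
    moreover have "h g = h u"
      using Cons.hyps(1) by (rule profile_eqD)
    ultimately show ?case
      using Cons.IH by (auto simp: \<Phi>_def)
  qed (simp add: \<Phi>_def)
  show ?thesis
    using eq v
  proof (induction "length ps * C - \<Phi> gs" arbitrary: u v gs rule: less_induct)
    case less
    obtain us where us: "u = fill ps us z" "list_all2 (\<lambda>g u. profile h k g \<subseteq> profile h k u) gs us"
      using fill_transfer_le[OF h N less.prems(3) ps n, of u] less.prems by auto
    have len: "length us = length ps"
      using us(2) less.prems(3) by (simp add: list_all2_lengthD)
    show ?case
    proof (cases "\<Phi> us = \<Phi> gs")
      case True
      then show ?thesis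
        using \<Phi>_mono[OF us(2)] us less.prems by blast
    next
      case False
      then have "\<Phi> gs < \<Phi> us"
        using \<Phi>_mono[OF us(2)] by simp
      moreover have "\<Phi> us \<le> length ps * C"
        using bound[of us] len by simp
      ultimately have "length ps * C - \<Phi> us < length ps * C - \<Phi> gs"
        by simp
      \<comment> \<open>The next round, with \<open>u\<close> and \<open>v\<close> exchanged, starts
        from the gaps found in \<open>u\<close>.\<close>
      from less.hyps[OF this less.prems(1)[symmetric] us(1) len]
      obtain gs' us' where gs': "v = fill ps gs' z" "u = fill ps us' z"
        "list_all2 (\<lambda>x y. profile h k x = profile h k y) gs' us'"
        "length us' = length ps" "map h us' = map h us"
        by blast
      have "list_all2 (\<lambda>x y. profile h k x = profile h k y) us' gs'"
        using gs'(3) by (simp add: list_all2_conv_all_nth)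
      moreover have "map h gs' = map h us'"
        using gs'(3) by (auto simp: list_all2_conv_all_nth list_eq_iff_nth_eq intro!: profile_eqD)
      moreover have "length gs' = length ps"
        using gs'(3,4) by (simp add: list_all2_lengthD)
      ultimately show ?thesis
        using gs' \<Phi>_mono[OF us(2)] by auto
    qed
  qed
qed

subsection \<open>The congruences attached to nonempty classes\<close>

text \<open>The emptiness flag mirrors the passage to \<open>lang_class_plus\<close>: for finite
  \<open>F\<close> inside a group prevariety \<open>G\<close>, the classes belong to
  \<open>lang_class_plus G\<close>, and that of \<open>[]\<close> is a singleton.\<close>

definition syn_plus :: "'a lang set \<Rightarrow> 'a list \<Rightarrow> bool \<times> ('a lang \<times> 'a list \<times> 'a list) set" where
  "syn_plus F w = (w = [], syn F w)"

lemma syn_plus_eq_iff: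
  "syn_plus F u = syn_plus F v \<longleftrightarrow> (u = [] \<longleftrightarrow> v = []) \<and> syn F u = syn F v"
  by (simp add: syn_plus_def)

lemma word_congruence_syn_plus: "word_congruence (syn_plus F)"
  unfolding word_congruence_def
proof (intro allI impI)
  fix u u' v v' assume "syn_plus F u = syn_plus F u'" "syn_plus F v = syn_plus F v'"
  then show "syn_plus F (u @ v) = syn_plus F (u' @ v')"
    using word_congruenceD[OF word_congruence_syn[of F], of u u' v v'] by (simp add: syn_plus_eq_iff)
qed

lemma syn_plus_Nil: "\<forall>w. syn_plus F w = syn_plus F [] \<longrightarrow> w = []"
  by (simp add: syn_plus_eq_iff)

lemma finite_range_syn_plus:
  assumes "finite F" and "\<And>L. L \<in> F \<Longrightarrow> group_lang L"
  shows "finite (range (syn_plus F))"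
proof (rule finite_subset)
  show "range (syn_plus F) \<subseteq> UNIV \<times> range (syn F)"
    by (auto simp: syn_plus_def)
  show "finite ((UNIV :: bool set) \<times> range (syn F))"
    using finite_range_syn[OF assms] by simp
qed

lemma profile_syn_plus_mono:
  assumes "F \<subseteq> F'" and "n \<le> n'" and "profile (syn_plus F') n' u \<subseteq> profile (syn_plus F') n' v"
  shows "profile (syn_plus F) n u \<subseteq> profile (syn_plus F) n v"
proof (rule profile_refine)
  show "syn_plus F x = syn_plus F y" if "syn_plus F' x = syn_plus F' y" for x y
    using that syn_mono[OF assms(1), of x y] by (simp add: syn_plus_eq_iff)
  show "profile (syn_plus F') n u \<subseteq> profile (syn_plus F') n v"
    using assms(2,3) by (rule profile_antimono)
qed

lemma profile_syn_plus_eq_mono: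
  assumes "F \<subseteq> F'" and "n \<le> n'" and "profile (syn_plus F') n' u = profile (syn_plus F') n' v"
  shows "profile (syn_plus F) n u = profile (syn_plus F) n v"
  using profile_syn_plus_mono[OF assms(1,2), of u v] profile_syn_plus_mono[OF assms(1,2), of v u]
    assms(3) by simp

text \<open>Each mark spoils at most one copy of \<open>x\<close>, and copies outnumber marks, so
  some copy lies inside a gap. A neutral \<open>y\<close> next to it keeps the class and the
  nonemptiness of that gap. The position \<open>i\<close> must not depend on \<open>y\<close>, which
  is later chosen in terms of \<open>i\<close>.\<close>

lemma tmpl_insert:
  assumes "tmpl (syn_plus F) n X" and "s @ word_power x m \<in> X" and "n < m" and x: "x \<noteq> []"
  shows "\<exists>i\<le>m. \<forall>y. syn F y = syn F [] \<longrightarrow> s @ word_power x i @ y @ word_power x (m - i) \<in> X"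
  using assms(1-3)
proof (induction n X arbitrary: s m rule: tmpl.induct)
  case (tmpl_class n u)
  have "syn_plus F (s @ y @ word_power x m) = syn_plus F u" if "syn F y = syn F []" for y
  proof -
    note D = word_congruenceD[OF word_congruence_syn]
    have "syn F (s @ y @ word_power x m) = syn F (s @ [] @ word_power x m)"
      by (intro D refl that)
    moreover have "word_power x m \<noteq> []"
      using tmpl_class(2) x by (simp add: word_power_eq_Nil_iff)
    ultimately show ?thesis
      using tmpl_class(1) by (simp add: syn_plus_eq_iff)
  qed
  then show ?case
    by (intro exI[of _ 0]) simp
next
  case (tmpl_mark n X a u)
  obtain k where m: "m = Suc k" "n < k"
    using tmpl_mark.prems(2) by (cases m) auto
  obtain p t where p: "s @ word_power x m = p @ a # t" "syn_plus F p = syn_plus F u" "t \<in> X"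
    using tmpl_mark.prems(1) by blast
  have "(s @ x) @ word_power x k = p @ a # t"
    using p(1) by (simp add: m)
  then obtain us where "s @ x = p @ us \<and> us @ word_power x k = a # t \<or>
    (s @ x) @ us = p \<and> word_power x k = us @ a # t"
    unfolding append_eq_append_conv2 by blast
  \<comment> \<open>Either the first mark lies in \<open>s @ x\<close>, and one mark and one copy of
    \<open>x\<close> are given up, or the first copy of \<open>x\<close> lies inside the first
    gap.\<close>
  then consider s' where "s @ x = p @ a # s'" "t = s' @ word_power x k"
    | us where "p = s @ x @ us" "word_power x k = us @ a # t"
    by (cases us) auto
  then show ?case
  proof cases
    case 1
    then obtain i where i: "i \<le> k" "\<And>y. syn F y = syn F [] \<Longrightarrow>
      s' @ word_power x i @ y @ word_power x (k - i) \<in> X"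
      using tmpl_mark.IH[of s' k] p(3) m(2) by blast
    have eq: "s @ word_power x (Suc i) @ y @ word_power x (m - Suc i) =
      p @ a # s' @ word_power x i @ y @ word_power x (k - i)" for y
      using 1(1) by (simp add: m)
    show ?thesis
    proof (rule exI[of _ "Suc i"], intro conjI allI impI)
      show "Suc i \<le> m"
        using i(1) m(1) by simp
      show "s @ word_power x (Suc i) @ y @ word_power x (m - Suc i) \<in>
        {x @ a # y | x y. syn_plus F x = syn_plus F u \<and> y \<in> X}" if "syn F y = syn F []" for y
        unfolding eq using p(2) i(2)[OF that] by blast
    qed
  next
    case 2
    have "syn_plus F (s @ x @ y @ us) = syn_plus F u" if "syn F y = syn F []" for y
    proof -
      note D = word_congruenceD[OF word_congruence_syn]
      have "syn F (s @ x @ y @ us) = syn F (s @ x @ [] @ us)"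
        by (intro D refl that)
      then show ?thesis
        using p(2) x by (simp add: 2 syn_plus_eq_iff)
    qed
    moreover have "s @ word_power x 1 @ y @ word_power x (m - 1) = (s @ x @ y @ us) @ a # t" for y
      using 2(2) by (simp add: m)
    ultimately show ?thesis
      using p(3) m by (intro exI[of _ 1]) fastforce
  qed
qed

text \<open>The pumping step behind growing chains: a long power of a loop word lies below the same
  power on both sides of any neutral word.\<close>

lemma profile_insert:
  assumes x: "x \<noteq> []" "syn F x = syn F []" and y: "syn F y = syn F []"
  shows "profile (syn_plus F) n (word_power x (Suc n)) \<subseteq>
    profile (syn_plus F) n (word_power x (Suc n) @ y @ word_power x (Suc n))"
proof
  fix X assume X: "X \<in> profile (syn_plus F) n (word_power x (Suc n))"
  let ?m = "Suc n"
  have "tmpl (syn_plus F) n X" "[] @ word_power x ?m \<in> X"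
    using X by (simp_all add: profile_def)
  then obtain i where i: "i \<le> ?m" "\<And>y. syn F y = syn F [] \<Longrightarrow>
      [] @ word_power x i @ y @ word_power x (?m - i) \<in> X"
    using tmpl_insert[of F n X "[]" ?m x] x(1) by blast
  note D = word_congruenceD[OF word_congruence_syn]
  have pow: "syn F (word_power x j) = syn F []" for j
    by (rule word_power_congruent_Nil[OF word_congruence_syn x(2)])
  \<comment> \<open>The word actually inserted is \<open>y\<close> padded by the missing powers, so
    that both sides become full powers of \<open>x\<close>; it is neutral because \<open>x\<close>
    and \<open>y\<close> are.\<close>
  have "syn F (word_power x (?m - i) @ y @ word_power x i) = syn F ([] @ [] @ [])"
    by (intro D pow y)
  then have eq: "syn F (word_power x (?m - i) @ y @ word_power x i) = syn F []"
    by simp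
  have "word_power x i @ (word_power x (?m - i) @ y @ word_power x i) @ word_power x (?m - i) \<in> X"
    using i(2)[OF eq] by (simp only: append_Nil append.assoc)
  moreover have "word_power x ?m = word_power x i @ word_power x (?m - i)"
    using word_power_add[of i "?m - i" x] i(1) by simp
  ultimately have "word_power x ?m @ y @ word_power x ?m \<in> X"
    by (simp del: replicate_Suc)
  then show "X \<in> profile (syn_plus F) n (word_power x ?m @ y @ word_power x ?m)"
    using X by (simp add: profile_def)
qed

subsection \<open>Profiles and the Boolean polynomial closure\<close>

lemma lang_class_plus_saturated:
  assumes "L \<in> lang_class_plus G"
  shows "\<exists>L'\<in>G. \<forall>u v. syn_plus {L'} u = syn_plus {L'} v \<longrightarrow> u \<in> L \<longrightarrow> v \<in> L"
proof -
  obtain L' where L': "L' \<in> G" "L = L' \<inter> nonempty_words \<or> L = L' \<union> {[]}"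
    using assms unfolding lang_class_plus_def by blast
  have "v \<in> L" if "syn_plus {L'} u = syn_plus {L'} v" "u \<in> L" for u v
    using that L'(2) syn_memD[of "{L'}" u v L'] by (auto simp: syn_plus_eq_iff nonempty_words_def)
  then show ?thesis
    using L'(1) by blast
qed

text \<open>One language of \<open>G\<close> per factor is collected in \<open>F\<close>; each word
  is then captured by the template formed from its own factors.\<close>

lemma marked_product_tmpl:
  assumes "L \<in> lang_class_plus G" and "\<forall>(a, K)\<in>set ps. K \<in> lang_class_plus G"
  shows "\<exists>F. finite F \<and> F \<subseteq> G \<and> (\<forall>w\<in>marked_product L ps.
    \<exists>X. tmpl (syn_plus F) (length ps) X \<and> w \<in> X \<and> X \<subseteq> marked_product L ps)"
  using assms
proof (induction L ps rule: marked_product.induct)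
  case (1 L)
  obtain L' where L': "L' \<in> G" and
    sat: "\<forall>u v. syn_plus {L'} u = syn_plus {L'} v \<longrightarrow> u \<in> L \<longrightarrow> v \<in> L"
    using lang_class_plus_saturated[OF 1(1)] by blast
  have "tmpl (syn_plus {L'}) 0 {v. syn_plus {L'} v = syn_plus {L'} w}" for w
    by (rule tmpl_class)
  moreover have "{v. syn_plus {L'} v = syn_plus {L'} w} \<subseteq> L" if "w \<in> L" for w
    using sat that by (metis (mono_tags, lifting) mem_Collect_eq subsetI)
  ultimately show ?case
    using L' by (intro exI[of _ "{L'}"]) fastforce
next
  case (2 L a K ps)
  obtain F where F: "finite F" "F \<subseteq> G" "\<forall>w\<in>marked_product K ps.
    \<exists>X. tmpl (syn_plus F) (length ps) X \<and> w \<in> X \<and> X \<subseteq> marked_product K ps"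
    using 2 by auto
  obtain L' where L': "L' \<in> G" and
    sat: "\<forall>u v. syn_plus {L'} u = syn_plus {L'} v \<longrightarrow> u \<in> L \<longrightarrow> v \<in> L"
    using lang_class_plus_saturated[OF 2(2)] by blast
  let ?F = "insert L' F"
  have refine: "syn_plus F x = syn_plus F y" "syn_plus {L'} x = syn_plus {L'} y"
    if "syn_plus ?F x = syn_plus ?F y" for x y
    using that syn_mono[of F ?F x y] syn_mono[of "{L'}" ?F x y] by (auto simp: syn_plus_eq_iff)
  have "\<exists>X. tmpl (syn_plus ?F) (Suc (length ps)) X \<and> w \<in> X \<and> X \<subseteq> marked_product L ((a, K) # ps)"
    if "w \<in> marked_product L ((a, K) # ps)" for w
  proof -
    from that obtain u v where uv: "w = u @ a # v" "u \<in> L" "v \<in> marked_product K ps"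
      by auto
    obtain X where X: "tmpl (syn_plus F) (length ps) X" "v \<in> X" "X \<subseteq> marked_product K ps"
      using F(3) uv(3) by blast
    have "\<exists>X'. tmpl (syn_plus ?F) (length ps) X' \<and> v \<in> X' \<and> X' \<subseteq> X"
      by (rule tmpl_refine[OF _ X(1,2)]) (rule refine(1))
    then obtain X' where X': "tmpl (syn_plus ?F) (length ps) X'" "v \<in> X'" "X' \<subseteq> X"
      by blast
    have "x \<in> L" if "syn_plus ?F x = syn_plus ?F u" for x
      using sat refine(2)[OF that[symmetric]] uv(2) by blast
    then have "{x @ a # y | x y. syn_plus ?F x = syn_plus ?F u \<and> y \<in> X'} \<subseteq>
      marked_product L ((a, K) # ps)"
      using X(3) X'(3) by fastforce
    moreover have "w \<in> {x @ a # y | x y. syn_plus ?F x = syn_plus ?F u \<and> y \<in> X'}"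
      using uv(1) X'(2) by blast
    ultimately show ?thesis
      using tmpl_mark[OF X'(1), of a u] by blast
  qed
  then show ?case
    using F(1,2) L' by (intro exI[of _ ?F]) simp
qed

text \<open>Membership is witnessed by a template contained in the language, so it survives when the
  profile grows. Finite unions take the union of the sets and the maximum of the bounds.\<close>

lemma Pol_saturated:
  assumes "K \<in> Pol (lang_class_plus G)"
  shows "\<exists>F n. finite F \<and> F \<subseteq> G \<and>
    (\<forall>u v. profile (syn_plus F) n u \<subseteq> profile (syn_plus F) n v \<longrightarrow> u \<in> K \<longrightarrow> v \<in> K)"
proof -
  obtain M where K: "K = \<Union>M" and "finite M" and M: "M \<subseteq> {marked_product L ps | L ps.
    L \<in> lang_class_plus G \<and> (\<forall>(a, K)\<in>set ps. K \<in> lang_class_plus G)}"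
    using assms unfolding Pol_def by blast
  from \<open>finite M\<close> M show ?thesis
    unfolding K
  proof (induction M)
    case empty
    show ?case by (rule exI[of _ "{}"]) simp
  next
    case (insert K M)
    obtain F n where F: "finite F" "F \<subseteq> G"
      "\<And>u v. profile (syn_plus F) n u \<subseteq> profile (syn_plus F) n v \<Longrightarrow> u \<in> \<Union>M \<Longrightarrow> v \<in> \<Union>M"
      using insert by auto
    obtain L ps where "K = marked_product L ps" "L \<in> lang_class_plus G"
      "\<forall>(a, K)\<in>set ps. K \<in> lang_class_plus G"
      using insert.prems by auto
    then obtain F' where F': "finite F'" "F' \<subseteq> G"
      "\<And>w. w \<in> K \<Longrightarrow> \<exists>X. tmpl (syn_plus F') (length ps) X \<and> w \<in> X \<and> X \<subseteq> K"
      using marked_product_tmpl by metis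
    let ?F = "F \<union> F'" and ?n = "max n (length ps)"
    have "v \<in> \<Union>(insert K M)" if le: "profile (syn_plus ?F) ?n u \<subseteq> profile (syn_plus ?F) ?n v"
      and u: "u \<in> \<Union>(insert K M)" for u v
    proof (cases "u \<in> K")
      case True
      have "profile (syn_plus F') (length ps) u \<subseteq> profile (syn_plus F') (length ps) v"
        by (rule profile_syn_plus_mono[OF _ _ le]) auto
      then show ?thesis
        using F'(3)[OF True] by (auto simp: profile_def)
    next
      case False
      have "profile (syn_plus F) n u \<subseteq> profile (syn_plus F) n v"
        by (rule profile_syn_plus_mono[OF _ _ le]) auto
      then show ?thesis
        using F(3) False u by blast
    qed
    then show ?case
      using F(1,2) F'(1,2) by (intro exI[of _ ?F] exI[of _ ?n]) blast
  qed
qed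

text \<open>The languages saturated for some profile form a Boolean algebra containing
  \<open>Pol\<close>. Complements call for equality of profiles in place of inclusion.\<close>

lemma BPol_saturated:
  assumes "K \<in> BPol (lang_class_plus G)"
  shows "\<exists>F n. finite F \<and> F \<subseteq> G \<and>
    (\<forall>u v. profile (syn_plus F) n u = profile (syn_plus F) n v \<longrightarrow> u \<in> K \<longrightarrow> v \<in> K)"
proof -
  define sat where "sat F n K \<longleftrightarrow>
    (\<forall>u v. profile (syn_plus F) n u = profile (syn_plus F) n v \<longrightarrow> u \<in> K \<longrightarrow> v \<in> K)"
    for F n and K :: "'a lang"
  define B where "B = {K. \<exists>F n. finite F \<and> F \<subseteq> G \<and> sat F n K}"
  have sat_mono: "sat F' n' K" if "sat F n K" "F \<subseteq> F'" "n \<le> n'" for F n F' n' K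
    unfolding sat_def
  proof (intro allI impI)
    fix u v assume eq: "profile (syn_plus F') n' u = profile (syn_plus F') n' v" and "u \<in> K"
    show "v \<in> K"
      by (rule that(1)[unfolded sat_def, rule_format, of u v, OF _ \<open>u \<in> K\<close>])
        (rule profile_syn_plus_eq_mono[OF that(2,3) eq])
  qed
  have "lang_boolean_algebra B"
    unfolding lang_boolean_algebra_def lang_lattice_def
  proof (intro conjI ballI)
    show "{} \<in> B" "UNIV \<in> B"
      by (auto simp: B_def sat_def)
    show "- K \<in> B" if "K \<in> B" for K
    proof -
      from that obtain F n where F: "finite F" "F \<subseteq> G" "sat F n K"
        unfolding B_def by blast
      have "sat F n (- K)"
        unfolding sat_def
      proof (intro allI impI ComplI notI)
        fix u v assume eq: "profile (syn_plus F) n u = profile (syn_plus F) n v"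
          and "u \<in> - K" and v: "v \<in> K"
        then show False
          using F(3)[unfolded sat_def, rule_format, OF eq[symmetric] v] by simp
      qed
      then show ?thesis
        using F unfolding B_def by blast
    qed
    fix K L assume "K \<in> B" "L \<in> B"
    then obtain F n F' n' where F: "finite F" "F \<subseteq> G" "sat F n K" "finite F'" "F' \<subseteq> G" "sat F' n' L"
      unfolding B_def by blast
    have "sat (F \<union> F') (max n n') K" "sat (F \<union> F') (max n n') L"
      using F(3,6) by (auto elim!: sat_mono)
    then have "sat (F \<union> F') (max n n') (K \<union> L)" "sat (F \<union> F') (max n n') (K \<inter> L)"
      unfolding sat_def by blast+
    then show "K \<union> L \<in> B" "K \<inter> L \<in> B"
      using F(1,2,4,5) unfolding B_def by (blast intro: finite_UnI)+
  qed
  moreover have "Pol (lang_class_plus G) \<subseteq> B"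
  proof
    fix K assume K: "K \<in> Pol (lang_class_plus G)"
    from Pol_saturated[OF K] obtain F n where F: "finite F" "F \<subseteq> G"
      and sat: "\<forall>u v. profile (syn_plus F) n u \<subseteq> profile (syn_plus F) n v \<longrightarrow> u \<in> K \<longrightarrow> v \<in> K"
      by (elim exE conjE)
    have "sat F n K"
      unfolding sat_def
    proof (intro allI impI)
      fix u v assume eq: "profile (syn_plus F) n u = profile (syn_plus F) n v" and "u \<in> K"
      then show "v \<in> K"
        using sat[rule_format, OF equalityD1[OF eq]] by simp
    qed
    then show "K \<in> B"
      using F unfolding B_def by blast
  qed
  ultimately have "K \<in> B"
    using BPol_induct_boolean_algebra assms by blast
  then show ?thesis
    unfolding B_def sat_def by simp
qed

section \<open>Saturated languages belong to the Boolean polynomial closure\<close>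

lemma syn_plus_class_mem:
  assumes G: "group_prevariety G" and F: "finite F" "F \<subseteq> G"
  shows "{w. syn_plus F w = syn_plus F u} \<in> lang_class_plus G"
proof (cases "u = []")
  case True
  have "{} \<in> G"
    using G by (simp add: group_prevariety_def prevariety_def lang_boolean_algebra_def lang_lattice_def)
  moreover have "{w. syn_plus F w = syn_plus F u} = {} \<union> {[]}"
    using True by (auto simp: syn_plus_eq_iff)
  ultimately show ?thesis
    unfolding lang_class_plus_def by blast
next
  case False
  have "{w. syn F w = syn F u} \<in> G"
    by (rule syn_saturated_mem[OF G F]) simp
  moreover have "{w. syn_plus F w = syn_plus F u} = {w. syn F w = syn F u} \<inter> nonempty_words"
    using False by (auto simp: syn_plus_eq_iff nonempty_words_def)
  ultimately show ?thesis
    unfolding lang_class_plus_def by blast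
qed

lemma tmpl_marked_product:
  assumes "\<And>u. {w. h w = h u} \<in> C" and "tmpl h n X"
  shows "\<exists>L ps. X = marked_product L ps \<and> L \<in> C \<and> (\<forall>(a, K)\<in>set ps. K \<in> C)"
  using assms(2)
proof (induction n X rule: tmpl.induct)
  case (tmpl_class n u)
  show ?case
    by (rule exI[of _ "{w. h w = h u}"], rule exI[of _ "[]"]) (simp add: assms(1))
next
  case (tmpl_mark n X a u)
  then obtain L ps where "X = marked_product L ps" "L \<in> C" "\<forall>(a, K)\<in>set ps. K \<in> C"
    by blast
  then show ?case
    by (intro exI[of _ "{w. h w = h u}"] exI[of _ "(a, L) # ps"]) (simp add: assms(1))
qed

text \<open>Templates are marked products of classes in \<open>lang_class_plus G\<close>, hence lie
  in \<open>Pol\<close>; there are finitely many, and a profile class is a Boolean combination of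
  them.\<close>

lemma profile_saturated_BPol:
  fixes G :: "('a :: finite) lang_class"
  assumes G: "group_prevariety G" and F: "finite F" "F \<subseteq> G"
    and sat: "\<And>u v. profile (syn_plus F) n u = profile (syn_plus F) n v \<Longrightarrow> u \<in> K \<Longrightarrow> v \<in> K"
  shows "K \<in> BPol (lang_class_plus G)"
proof (rule lang_boolean_algebra_saturated[OF lang_boolean_algebra_BPol])
  let ?M = "{X. tmpl (syn_plus F) n X}"
  have "\<And>L. L \<in> F \<Longrightarrow> group_lang L"
    using F(2) G by (auto simp: group_prevariety_def)
  then show "finite ?M"
    by (intro finite_tmpl finite_range_syn_plus F(1))
  show "?M \<subseteq> BPol (lang_class_plus G)"
  proof
    fix X assume "X \<in> ?M"
    then obtain L ps where "X = marked_product L ps" "L \<in> lang_class_plus G"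
      "\<forall>(a, K)\<in>set ps. K \<in> lang_class_plus G"
      using tmpl_marked_product[OF syn_plus_class_mem[OF G F], of n X] by blast
    then have "X \<in> Pol (lang_class_plus G)"
      unfolding Pol_def by (intro CollectI exI[of _ "{X}"]) auto
    then show "X \<in> BPol (lang_class_plus G)"
      using Pol_subset_BPol by blast
  qed
  show "y \<in> K" if "\<And>X. X \<in> ?M \<Longrightarrow> x \<in> X \<longleftrightarrow> y \<in> X" and "x \<in> K" for x y
    using that by (intro sat[of x y]) (auto simp: profile_def)
qed

subsection \<open>Runs\<close>

lemma nfa_run_append: "nfa_run \<delta> p u q \<Longrightarrow> nfa_run \<delta> q v r \<Longrightarrow> nfa_run \<delta> p (u @ v) r"
  by (induction rule: nfa_run.induct) (auto intro: nfa_run.intros)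

lemma nfa_run_append_iff: "nfa_run \<delta> p (u @ v) r \<longleftrightarrow> (\<exists>q. nfa_run \<delta> p u q \<and> nfa_run \<delta> q v r)"
proof
  show "nfa_run \<delta> p (u @ v) r \<Longrightarrow> \<exists>q. nfa_run \<delta> p u q \<and> nfa_run \<delta> q v r"
  proof (induction u arbitrary: p)
    case Nil
    then show ?case
      using nfa_run_Nil by fastforce
  next
    case (Cons a u)
    from Cons.prems obtain p' where "(p, a, p') \<in> \<delta>" "nfa_run \<delta> p' (u @ v) r"
      by (auto elim: nfa_run.cases)
    then show ?case
      using Cons.IH by (blast intro: nfa_run.intros)
  qed
qed (blast intro: nfa_run_append)

lemma nfa_run_word_power: "nfa_run \<delta> p x p \<Longrightarrow> nfa_run \<delta> p (word_power x n) p"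
  by (induction n) (auto intro: nfa_run_append nfa_run_Nil)

lemma nfa_run_states:
  assumes "is_nfa Q \<delta>" and "nfa_run \<delta> p w q" and "w \<noteq> []"
  shows "p \<in> Q" and "q \<in> Q"
proof -
  have "(w \<noteq> [] \<longrightarrow> p \<in> Q) \<and> (w = [] \<longrightarrow> p = q) \<and> (w \<noteq> [] \<longrightarrow> q \<in> Q)"
    using assms(2)
  proof (induction rule: nfa_run.induct)
    case (nfa_run_Cons q a r w s)
    then show ?case
      using assms(1) by (cases "w = []") (auto simp: is_nfa_def)
  qed simp
  then show "p \<in> Q" "q \<in> Q"
    using assms(3) by auto
qed

lemma eps_run_append: "eps_run \<gamma> p u q \<Longrightarrow> eps_run \<gamma> q v r \<Longrightarrow> eps_run \<gamma> p (u @ v) r"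
  by (induction rule: eps_run.induct) (auto intro: eps_run.intros)

lemma eps_run_gamma_plus:
  "nfa_run \<delta> p1 w q1 \<Longrightarrow> nfa_run \<delta> p2 w q2 \<Longrightarrow> nfa_run \<delta> p3 w q3 \<Longrightarrow>
    eps_run (gamma_plus Q \<delta> S) (p1, p2, p3) w (q1, q2, q3)"
proof (induction w arbitrary: p1 p2 p3)
  case Nil
  then have "p1 = q1" "p2 = q2" "p3 = q3"
    by (auto elim: nfa_run.cases)
  then show ?case
    by (simp add: eps_run_Nil)
next
  case (Cons a w)
  obtain r1 where r1: "(p1, a, r1) \<in> \<delta>" "nfa_run \<delta> r1 w q1"
    using Cons.prems(1) by (auto elim: nfa_run.cases)
  obtain r2 where r2: "(p2, a, r2) \<in> \<delta>" "nfa_run \<delta> r2 w q2"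
    using Cons.prems(2) by (auto elim: nfa_run.cases)
  obtain r3 where r3: "(p3, a, r3) \<in> \<delta>" "nfa_run \<delta> r3 w q3"
    using Cons.prems(3) by (auto elim: nfa_run.cases)
  have "((p1, p2, p3), Some a, (r1, r2, r3)) \<in> gamma_plus Q \<delta> S"
    using r1 r2 r3 unfolding gamma_plus_def by blast
  then show ?case
    using Cons.IH[OF r1(2) r2(2) r3(2)] by (rule eps_run_Cons)
qed

section \<open>Monotonicity of the operator\<close>

lemma gamma_plus_mono: "S \<subseteq> S' \<Longrightarrow> gamma_plus Q \<delta> S \<subseteq> gamma_plus Q \<delta> S'"
  unfolding gamma_plus_def by blast

lemma eps_run_mono:
  assumes "\<gamma> \<subseteq> \<gamma>'" and "eps_run \<gamma> p w q"
  shows "eps_run \<gamma>' p w q"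
  using assms(2)
proof (induction rule: eps_run.induct)
  case (eps_run_Nil q)
  show ?case by (rule eps_run.eps_run_Nil)
next
  case (eps_run_eps q r w s)
  show ?case
    by (rule eps_run.eps_run_eps[OF subsetD[OF assms(1) eps_run_eps.hyps(1)] eps_run_eps.IH])
next
  case (eps_run_Cons q a r w s)
  show ?case
    by (rule eps_run.eps_run_Cons[OF subsetD[OF assms(1) eps_run_Cons.hyps(1)] eps_run_Cons.IH])
qed

lemma tau_plus_mono:
  assumes "S \<subseteq> S'"
  shows "tau_plus G Q \<delta> S \<subseteq> tau_plus G Q \<delta> S'"
proof -
  have sub: "eps_lang (gamma_plus Q \<delta> S) p q \<subseteq> eps_lang (gamma_plus Q \<delta> S') p q" for p q
    unfolding eps_lang_def by (rule Collect_mono) (intro impI eps_run_mono[OF gamma_plus_mono[OF assms]])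
  have "separable G {[]} (eps_lang (gamma_plus Q \<delta> S) p q)"
    if sep: "separable G {[]} (eps_lang (gamma_plus Q \<delta> S') p q)" for p q
  proof -
    from sep obtain K where "K \<in> G" "{[]} \<subseteq> K" "K \<inter> eps_lang (gamma_plus Q \<delta> S') p q = {}"
      unfolding separable_def by (elim bexE conjE)
    then show ?thesis
      unfolding separable_def using sub[of p q] by (intro bexI[of _ K]) auto
  qed
  then show ?thesis
    unfolding tau_plus_def by blast
qed

subsection \<open>Sound sets consist of inseparable quadruples\<close>

text \<open>The words alternate, with \<open>K\<close> at index 0. Asking for inclusion of profiles
  lets chains be prolonged at the front, while finiteness forces long chains to stall.\<close>

definition profile_chain ::
  "('a list \<Rightarrow> 'b) \<Rightarrow> nat \<Rightarrow> nat \<Rightarrow> 'a lang \<Rightarrow> 'a lang \<Rightarrow> (nat \<Rightarrow> 'a list) \<Rightarrow> bool" where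
  "profile_chain h n m K L c \<longleftrightarrow> (\<forall>i<m. c i \<in> (if even i then K else L)) \<and>
     (\<forall>i. Suc i < m \<longrightarrow> profile h n (c i) \<subseteq> profile h n (c (Suc i)))"

lemma profile_chain_append:
  assumes "word_congruence h" and "profile_chain h n m K L c" and "profile_chain h n m K' L' c'"
    and "\<And>u v. u \<in> K \<Longrightarrow> v \<in> K' \<Longrightarrow> u @ v \<in> K''" and "\<And>u v. u \<in> L \<Longrightarrow> v \<in> L' \<Longrightarrow> u @ v \<in> L''"
  shows "profile_chain h n m K'' L'' (\<lambda>i. c i @ c' i)"
  unfolding profile_chain_def
proof (intro conjI allI impI)
  fix i assume "i < m"
  then have "c i \<in> (if even i then K else L)" "c' i \<in> (if even i then K' else L')"
    using assms(2,3) unfolding profile_chain_def by blast+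
  then show "c i @ c' i \<in> (if even i then K'' else L'')"
    using assms(4,5) by (cases "even i") simp_all
next
  fix i assume "Suc i < m"
  then show "profile h n (c i @ c' i) \<subseteq> profile h n (c (Suc i) @ c' (Suc i))"
    using assms(2,3) unfolding profile_chain_def by (intro profile_append_mono[OF assms(1)]) auto
qed

lemma profile_chain_const: "w \<in> K \<Longrightarrow> w \<in> L \<Longrightarrow> profile_chain h n m K L (\<lambda>_. w)"
  by (simp add: profile_chain_def)

lemma profile_chain_stationary:
  fixes h :: "('a :: finite) list \<Rightarrow> 'b"
  assumes fin: "finite (range h)"
  shows "\<exists>m. \<forall>K L c. profile_chain h n m K L c \<longrightarrow>
    (\<exists>i. Suc i < m \<and> profile h n (c i) = profile h n (c (Suc i)))"
proof -
  define C where "C = card {X. tmpl h n X}"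
  \<comment> \<open>If all inclusions among \<open>C + 2\<close> words were strict, the last profile
    would have more than \<open>C\<close> templates.\<close>
  have "\<exists>i. Suc i < C + 2 \<and> profile h n (c i) = profile h n (c (Suc i))"
    if chain: "profile_chain h n (C + 2) K L c" for K L c
  proof (rule ccontr)
    assume *: "\<nexists>i. Suc i < C + 2 \<and> profile h n (c i) = profile h n (c (Suc i))"
    have "i \<le> card (profile h n (c i))" if "i < C + 2" for i
      using that
    proof (induction i)
      case (Suc i)
      have "profile h n (c i) \<subset> profile h n (c (Suc i))"
        using chain * Suc.prems unfolding profile_chain_def by blast
      then have "card (profile h n (c i)) < card (profile h n (c (Suc i)))"
        by (rule psubset_card_mono[OF finite_profile[OF fin]])
      then show ?case
        using Suc by simp
    qed simp
    from this[of "Suc C"] have "Suc C \<le> card (profile h n (c (Suc C)))"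
      by simp
    also have "\<dots> \<le> C"
      unfolding C_def by (rule card_mono[OF finite_tmpl[OF fin]]) (auto simp: profile_def)
    finally show False by simp
  qed
  then show ?thesis by blast
qed

text \<open>Induction on the run: one word \<open>f\<close> follows the first component, a chain
  \<open>c\<close> the other two. At an epsilon transition \<open>f\<close> receives a power of the
  common loop word, and \<open>c\<close> receives this power on both sides of a chain for the
  quadruple used, so \<open>f\<close> stays below \<open>c 0\<close>.\<close>

lemma eps_run_profile_chain:
  assumes F: "finite F" "\<And>L. L \<in> F \<Longrightarrow> group_lang L"
    and S: "\<And>q2 r2 q3 r3. (q2, r2, q3, r3) \<in> S \<Longrightarrow> \<exists>d. (\<forall>i<m. syn F (d i) = syn F []) \<and>
      profile_chain (syn_plus F) n m (nfa_lang \<delta> q2 r2) (nfa_lang \<delta> q3 r3) d"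
    and run: "eps_run (gamma_plus Q \<delta> S) p w p'"
  shows "\<exists>f c. f \<in> nfa_lang \<delta> (fst p) (fst p') \<and> syn F f = syn F w \<and>
    (\<forall>i<m. syn F (c i) = syn F w) \<and>
    profile_chain (syn_plus F) n m (nfa_lang \<delta> (fst (snd p)) (fst (snd p')))
      (nfa_lang \<delta> (snd (snd p)) (snd (snd p'))) c \<and>
    (0 < m \<longrightarrow> profile (syn_plus F) n f \<subseteq> profile (syn_plus F) n (c 0))"
  using run
proof (induction rule: eps_run.induct)
  case (eps_run_Nil q)
  show ?case
    by (intro exI[of _ "[]"] exI[of _ "\<lambda>_. []"])
      (auto simp: nfa_lang_def nfa_run_Nil intro: profile_chain_const)
next
  case (eps_run_eps q r w s)
  note D = word_congruenceD[OF word_congruence_syn[of F]]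
  obtain q1 q2 q3 r2 r3 x where qr: "q = (q1, q2, q3)" "r = (q1, r2, r3)" "(q2, r2, q3, r3) \<in> S"
    and x: "x \<noteq> []" "nfa_run \<delta> q1 x q1" "nfa_run \<delta> q2 x q2" "nfa_run \<delta> q3 x q3"
      "nfa_run \<delta> r2 x r2" "nfa_run \<delta> r3 x r3"
    using eps_run_eps.hyps(1) unfolding gamma_plus_def nonempty_words_def nfa_lang_def by blast
  obtain s1 s2 s3 where s: "s = (s1, s2, s3)"
    by (cases s) auto
  obtain f c where f: "nfa_run \<delta> q1 f s1" "syn F f = syn F w"
    and c: "\<And>i. i < m \<Longrightarrow> syn F (c i) = syn F w"
      "profile_chain (syn_plus F) n m (nfa_lang \<delta> r2 s2) (nfa_lang \<delta> r3 s3) c"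
    and fc: "0 < m \<Longrightarrow> profile (syn_plus F) n f \<subseteq> profile (syn_plus F) n (c 0)"
    using eps_run_eps.IH by (auto simp: qr s nfa_lang_def)
  obtain d where d: "\<And>i. i < m \<Longrightarrow> syn F (d i) = syn F []"
    "profile_chain (syn_plus F) n m (nfa_lang \<delta> q2 r2) (nfa_lang \<delta> q3 r3) d"
    using S[OF qr(3)] by blast
  obtain k where k: "k > 0" "\<And>x. syn F (word_power x k) = syn F []"
    using syn_exponent[OF F] by blast
  \<comment> \<open>The exponent \<open>k\<close> makes the loop word neutral; the
    \<open>Suc n\<close> copies of \<open>y\<close> in \<open>z\<close> outnumber the marks, as
    \<open>profile_insert\<close> requires.\<close>
  define y where "y = word_power x k"
  have y: "y \<noteq> []" "syn F y = syn F []"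
    using k x(1) by (simp_all add: y_def word_power_eq_Nil_iff)
  define z where "z = word_power y (Suc n)"
  have z_syn: "syn F z = syn F []"
    unfolding z_def by (rule word_power_congruent_Nil[OF word_congruence_syn y(2)])
  have z: "nfa_run \<delta> p z p" if "nfa_run \<delta> p x p" for p
    unfolding z_def y_def using that by (intro nfa_run_word_power)
  let ?c = "\<lambda>i. (z @ d i @ z) @ c i"
  have "profile_chain (syn_plus F) n m (nfa_lang \<delta> q2 r2) (nfa_lang \<delta> q3 r3) (\<lambda>i. z @ d i @ z)"
  proof (rule profile_chain_append[OF word_congruence_syn_plus profile_chain_const])
    show "profile_chain (syn_plus F) n m (nfa_lang \<delta> q2 r2) (nfa_lang \<delta> q3 r3) (\<lambda>i. d i @ z)"
      by (rule profile_chain_append[OF word_congruence_syn_plus d(2) profile_chain_const[of z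
              "nfa_lang \<delta> r2 r2" "nfa_lang \<delta> r3 r3"]])
        (use z x in \<open>auto simp: nfa_lang_def intro: nfa_run_append\<close>)
    show "z \<in> nfa_lang \<delta> q2 q2" "z \<in> nfa_lang \<delta> q3 q3"
      using z x by (simp_all add: nfa_lang_def)
  qed (auto simp: nfa_lang_def intro: nfa_run_append)
  then have 1: "profile_chain (syn_plus F) n m (nfa_lang \<delta> q2 s2) (nfa_lang \<delta> q3 s3) ?c"
    by (rule profile_chain_append[OF word_congruence_syn_plus _ c(2)])
      (auto simp: nfa_lang_def intro: nfa_run_append)
  have 2: "syn F (?c i) = syn F w" if "i < m" for i
  proof -
    have "syn F (?c i) = syn F (([] @ [] @ []) @ w)"
      by (rule D[OF D[OF z_syn D[OF d(1)[OF that] z_syn]] c(1)[OF that]])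
    then show ?thesis by simp
  qed
  have 3: "syn F (z @ f) = syn F w"
    using D[OF z_syn f(2)] by simp
  have 4: "z @ f \<in> nfa_lang \<delta> q1 s1"
    unfolding nfa_lang_def using nfa_run_append[OF z[OF x(2)] f(1)] by simp
  have 5: "profile (syn_plus F) n (z @ f) \<subseteq> profile (syn_plus F) n (?c 0)" if "0 < m"
  proof (rule profile_append_mono[OF word_congruence_syn_plus _ fc[OF that]])
    show "profile (syn_plus F) n z \<subseteq> profile (syn_plus F) n (z @ d 0 @ z)"
      unfolding z_def by (rule profile_insert[OF y d(1)[OF that]])
  qed
  show ?case
    unfolding qr s fst_conv snd_conv
    by (rule exI[of _ "z @ f"], rule exI[of _ "?c"]) (intro conjI allI impI 1 2 3 4 5)
next
  case (eps_run_Cons q a r w s)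
  note D = word_congruenceD[OF word_congruence_syn[of F] refl, of _ _ "[a]"]
  obtain q1 q2 q3 r1 r2 r3 where qr: "q = (q1, q2, q3)" "r = (r1, r2, r3)"
    and \<delta>: "(q1, a, r1) \<in> \<delta>" "(q2, a, r2) \<in> \<delta>" "(q3, a, r3) \<in> \<delta>"
    using eps_run_Cons.hyps(1) unfolding gamma_plus_def by blast
  obtain s1 s2 s3 where s: "s = (s1, s2, s3)"
    by (cases s) auto
  obtain f c where f: "nfa_run \<delta> r1 f s1" "syn F f = syn F w"
    and c: "\<And>i. i < m \<Longrightarrow> syn F (c i) = syn F w"
      "profile_chain (syn_plus F) n m (nfa_lang \<delta> r2 s2) (nfa_lang \<delta> r3 s3) c"
    and fc: "0 < m \<Longrightarrow> profile (syn_plus F) n f \<subseteq> profile (syn_plus F) n (c 0)"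
    using eps_run_Cons.IH by (auto simp: qr s nfa_lang_def)
  have 1: "profile_chain (syn_plus F) n m (nfa_lang \<delta> q2 s2) (nfa_lang \<delta> q3 s3) (\<lambda>i. [a] @ c i)"
    by (rule profile_chain_append[OF word_congruence_syn_plus profile_chain_const[of "[a]" "{[a]}" "{[a]}"] c(2)])
      (use \<delta> in \<open>auto simp: nfa_lang_def intro: nfa_run_Cons\<close>)
  have 2: "syn F ([a] @ c i) = syn F (a # w)" if "i < m" for i
    using D[OF c(1)[OF that]] by simp
  have 3: "syn F ([a] @ f) = syn F (a # w)"
    using D[OF f(2)] by simp
  have 4: "[a] @ f \<in> nfa_lang \<delta> q1 s1"
    unfolding nfa_lang_def using nfa_run_Cons[OF \<delta>(1) f(1)] by simp
  have 5: "profile (syn_plus F) n ([a] @ f) \<subseteq> profile (syn_plus F) n ([a] @ c 0)" if "0 < m"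
    by (rule profile_append_mono[OF word_congruence_syn_plus order_refl fc[OF that]])
  show ?case
    unfolding qr s fst_conv snd_conv
    by (rule exI[of _ "[a] @ f"], rule exI[of _ "\<lambda>i. [a] @ c i"]) (intro conjI allI impI 1 2 3 4 5)
qed

lemma not_separable_Nil:
  assumes G: "group_prevariety G" and F: "finite F" "F \<subseteq> G" and "\<not> separable G {[]} L"
  shows "\<exists>w\<in>L. syn F w = syn F []"
proof -
  have "{w. syn F w = syn F []} \<in> G"
    by (rule syn_saturated_mem[OF G F]) simp
  then have "{w. syn F w = syn F []} \<inter> L \<noteq> {}"
    using assms(4) unfolding separable_def by auto
  then show ?thesis by auto
qed

text \<open>A run from \<open>(q, s, q)\<close> to \<open>(r, t, r)\<close> yields a word
  \<open>f\<close> of L(q,r) below a chain that starts in L(s,t). Putting \<open>f\<close> in front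
  restores the parity and adds one word.\<close>

lemma tau_plus_profile_chain:
  assumes G: "group_prevariety G" and F: "finite F" "F \<subseteq> G" and S: "S \<subseteq> tau_plus G Q \<delta> S"
  shows "(q, r, s, t) \<in> S \<Longrightarrow> \<exists>d. (\<forall>i<m. syn F (d i) = syn F []) \<and>
    profile_chain (syn_plus F) n m (nfa_lang \<delta> q r) (nfa_lang \<delta> s t) d"
proof (induction m arbitrary: q r s t)
  case 0
  show ?case by (simp add: profile_chain_def)
next
  case (Suc m)
  have grp: "\<And>L. L \<in> F \<Longrightarrow> group_lang L"
    using F(2) G by (auto simp: group_prevariety_def)
  have "\<not> separable G {[]} (eps_lang (gamma_plus Q \<delta> S) (q, s, q) (r, t, r))"
    using Suc.prems S unfolding tau_plus_def by blast
  then obtain w where w: "eps_run (gamma_plus Q \<delta> S) (q, s, q) w (r, t, r)" "syn F w = syn F []"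
    using not_separable_Nil[OF G F] unfolding eps_lang_def by blast
  obtain f c where f: "f \<in> nfa_lang \<delta> q r" "syn F f = syn F []"
    and c: "\<And>i. i < m \<Longrightarrow> syn F (c i) = syn F []"
      "profile_chain (syn_plus F) n m (nfa_lang \<delta> s t) (nfa_lang \<delta> q r) c"
    and fc: "0 < m \<Longrightarrow> profile (syn_plus F) n f \<subseteq> profile (syn_plus F) n (c 0)"
    using eps_run_profile_chain[OF F(1) grp Suc.IH w(1)] w(2) by auto
  define d where "d i = (case i of 0 \<Rightarrow> f | Suc j \<Rightarrow> c j)" for i
  have d: "d 0 = f" "d (Suc j) = c j" for j
    by (simp_all add: d_def)
  have "syn F (d i) = syn F []" "d i \<in> (if even i then nfa_lang \<delta> q r else nfa_lang \<delta> s t)"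
    if "i < Suc m" for i
    using that f c by (cases i; auto simp: d profile_chain_def)+
  moreover have "profile (syn_plus F) n (d i) \<subseteq> profile (syn_plus F) n (d (Suc i))" if "Suc i < Suc m" for i
    using that fc c(2) by (cases i) (auto simp: d profile_chain_def)
  ultimately show ?case
    unfolding profile_chain_def by blast
qed

lemma sound_subset_inseparable_quads:
  fixes G :: "('a :: finite) lang_class"
  assumes G: "group_prevariety G" and S: "S \<subseteq> tau_plus G Q \<delta> S"
  shows "S \<subseteq> inseparable_quads (BPol (lang_class_plus G)) G Q \<delta>"
proof
  fix x assume "x \<in> S"
  then obtain q r s t where x: "x = (q, r, s, t)" "(q, r, s, t) \<in> S"
    by (cases x) auto
  have Q: "(q, r, s, t) \<in> Q \<times> Q \<times> Q \<times> Q"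
    using S x(2) unfolding tau_plus_def by blast
  have "\<not> separable_under_control (BPol (lang_class_plus G)) G (nfa_lang \<delta> q r) (nfa_lang \<delta> s t)"
  proof
    assume "separable_under_control (BPol (lang_class_plus G)) G (nfa_lang \<delta> q r) (nfa_lang \<delta> s t)"
    then obtain H K where H: "H \<in> G" "[] \<in> H" and K: "K \<in> BPol (lang_class_plus G)"
      "nfa_lang \<delta> q r \<inter> H \<subseteq> K" "K \<inter> (nfa_lang \<delta> s t \<inter> H) = {}"
      unfolding separable_under_control_def separable_def by blast
    from BPol_saturated[OF K(1)] obtain F n where F: "finite F" "F \<subseteq> G"
      and sat: "\<forall>u v. profile (syn_plus F) n u = profile (syn_plus F) n v \<longrightarrow> u \<in> K \<longrightarrow> v \<in> K"
      by (elim exE conjE)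
    \<comment> \<open>Adding \<open>H\<close> puts every word congruent to \<open>[]\<close> into
      \<open>H\<close>, so the whole chain obeys the control.\<close>
    let ?F = "insert H F"
    have F': "finite ?F" "?F \<subseteq> G"
      using F H by auto
    then have "finite (range (syn_plus ?F))"
      using G by (intro finite_range_syn_plus) (auto simp: group_prevariety_def)
    then obtain m where m: "\<And>K L c. profile_chain (syn_plus ?F) n m K L c \<Longrightarrow>
      \<exists>i. Suc i < m \<and> profile (syn_plus ?F) n (c i) = profile (syn_plus ?F) n (c (Suc i))"
      using profile_chain_stationary by blast
    obtain d where d: "\<And>i. i < m \<Longrightarrow> syn ?F (d i) = syn ?F []"
      "profile_chain (syn_plus ?F) n m (nfa_lang \<delta> q r) (nfa_lang \<delta> s t) d"
      using tau_plus_profile_chain[OF G F' S x(2)] by blast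
    obtain i where i: "Suc i < m" "profile (syn_plus ?F) n (d i) = profile (syn_plus ?F) n (d (Suc i))"
      using m[OF d(2)] by blast
    have eq: "profile (syn_plus F) n (d i) = profile (syn_plus F) n (d (Suc i))"
      by (rule profile_syn_plus_eq_mono[OF _ order_refl i(2)]) auto
    have "d j \<in> H" if "j < m" for j
      using syn_memD[OF d(1)[OF that], of H] H(2) by simp
    then have "d i \<in> H" "d (Suc i) \<in> H"
      using i(1) by auto
    moreover have "d i \<in> K \<longleftrightarrow> d (Suc i) \<in> K"
      using sat[rule_format, OF eq] sat[rule_format, OF eq[symmetric]] by blast
    \<comment> \<open>The two words of equal profile lie on opposite sides of the pair; the parity
      of \<open>i\<close> decides which is which.\<close>
    moreover have "d i \<in> (if even i then nfa_lang \<delta> q r else nfa_lang \<delta> s t)"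
      "d (Suc i) \<in> (if even i then nfa_lang \<delta> s t else nfa_lang \<delta> q r)"
      using d(2) i(1) unfolding profile_chain_def by auto
    ultimately show False
      using K(2,3) by (cases "even i") auto
  qed
  then show "x \<in> inseparable_quads (BPol (lang_class_plus G)) G Q \<delta>"
    using Q by (simp add: inseparable_quads_def x(1))
qed

subsection \<open>Inseparable quadruples form a sound set\<close>

text \<open>Complementing a separator exchanges the two languages.\<close>

lemma inseparable_quads_sym:
  assumes "(q, r, s, t) \<in> inseparable_quads (BPol C) D Q \<delta>"
  shows "(s, t, q, r) \<in> inseparable_quads (BPol C) D Q \<delta>"
proof -
  have sep: "separable (BPol C) K L" if LK: "separable (BPol C) L K" for K L
  proof -
    from LK obtain X where X: "X \<in> BPol C" "L \<subseteq> X" "X \<inter> K = {}"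
      unfolding separable_def by blast
    have "- X \<in> BPol C"
      by (rule lang_boolean_algebraD(5)[OF lang_boolean_algebra_BPol X(1)])
    then show ?thesis
      unfolding separable_def using X(2,3) by (intro bexI[of _ "- X"]) auto
  qed
  have "separable_under_control (BPol C) D (nfa_lang \<delta> q r) (nfa_lang \<delta> s t)"
    if "separable_under_control (BPol C) D (nfa_lang \<delta> s t) (nfa_lang \<delta> q r)"
    using that sep unfolding separable_under_control_def by metis
  then show ?thesis
    using assms unfolding inseparable_quads_def by auto
qed

text \<open>Inseparability under control at a finite level: the class of \<open>[]\<close> is the
  control language and unions of profile classes are the separators.\<close>

definition profile_inseparable :: "'a lang set \<Rightarrow> nat \<Rightarrow> 'a lang \<Rightarrow> 'a lang \<Rightarrow> bool" where
  "profile_inseparable F n K L \<longleftrightarrow> (\<exists>u\<in>K. \<exists>v\<in>L. syn F u = syn F [] \<and> syn F v = syn F [] \<and>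
     profile (syn_plus F) n u = profile (syn_plus F) n v)"

lemma profile_inseparable_mono:
  assumes "F \<subseteq> F'" and "n \<le> n'" and "profile_inseparable F' n' K L"
  shows "profile_inseparable F n K L"
proof -
  from assms(3) obtain u v where uv: "u \<in> K" "v \<in> L" "syn F' u = syn F' []" "syn F' v = syn F' []"
    and eq: "profile (syn_plus F') n' u = profile (syn_plus F') n' v"
    unfolding profile_inseparable_def by blast
  have "syn F u = syn F []" "syn F v = syn F []"
    by (rule syn_mono[OF assms(1) uv(3)], rule syn_mono[OF assms(1) uv(4)])
  then show ?thesis
    unfolding profile_inseparable_def
    using uv(1,2) profile_syn_plus_eq_mono[OF assms(1,2) eq] by (intro bexI[of _ u] bexI[of _ v]) auto
qed

lemma separable_imp_not_profile_inseparable: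
  assumes "separable_under_control (BPol (lang_class_plus G)) G K L"
  shows "\<exists>F n. finite F \<and> F \<subseteq> G \<and> \<not> profile_inseparable F n K L"
proof -
  obtain H X where H: "H \<in> G" "[] \<in> H" and X: "X \<in> BPol (lang_class_plus G)"
    "K \<inter> H \<subseteq> X" "X \<inter> (L \<inter> H) = {}"
    using assms unfolding separable_under_control_def separable_def by blast
  from BPol_saturated[OF X(1)] obtain F n where F: "finite F" "F \<subseteq> G"
    and sat: "\<forall>u v. profile (syn_plus F) n u = profile (syn_plus F) n v \<longrightarrow> u \<in> X \<longrightarrow> v \<in> X"
    by (elim exE conjE)
  have "\<not> profile_inseparable (insert H F) n K L"
  proof
    assume "profile_inseparable (insert H F) n K L"
    then obtain u v where uv: "u \<in> K" "v \<in> L" "syn (insert H F) u = syn (insert H F) []"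
      "syn (insert H F) v = syn (insert H F) []"
      and eq: "profile (syn_plus (insert H F)) n u = profile (syn_plus (insert H F)) n v"
      unfolding profile_inseparable_def by blast
    have "profile (syn_plus F) n u = profile (syn_plus F) n v"
      by (rule profile_syn_plus_eq_mono[OF _ order_refl eq]) auto
    moreover have "u \<in> H" "v \<in> H"
      using syn_memD[OF uv(3), of H] syn_memD[OF uv(4), of H] H(2) by simp_all
    ultimately show False
      using sat[rule_format, of u v] uv(1,2) X(2,3) by blast
  qed
  then show ?thesis
    using F H(1) by (intro exI[of _ "insert H F"] exI[of _ n]) simp
qed

text \<open>Otherwise the class of \<open>[]\<close> would serve as control language and the profile
  saturation of the controlled part of \<open>K\<close> as separator.\<close>

lemma inseparable_imp_profile_inseparable:
  fixes G :: "('a :: finite) lang_class"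
  assumes G: "group_prevariety G" and F: "finite F" "F \<subseteq> G"
    and insep: "\<not> separable_under_control (BPol (lang_class_plus G)) G K L"
  shows "profile_inseparable F n K L"
proof (rule ccontr)
  assume not: "\<not> profile_inseparable F n K L"
  define H where "H = {w. syn F w = syn F []}"
  have H: "H \<in> G"
    unfolding H_def by (rule syn_saturated_mem[OF G F]) simp
  define X where "X = {w. \<exists>u\<in>K \<inter> H. profile (syn_plus F) n u = profile (syn_plus F) n w}"
  have "X \<in> BPol (lang_class_plus G)"
    by (rule profile_saturated_BPol[OF G F, of n]) (auto simp: X_def)
  moreover have "K \<inter> H \<subseteq> X"
    by (auto simp: X_def)
  moreover have "X \<inter> (L \<inter> H) = {}"
    using not unfolding profile_inseparable_def X_def H_def by blast
  moreover have "[] \<in> H"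
    by (simp add: H_def)
  ultimately show False
    using H insep unfolding separable_under_control_def separable_def by blast
qed

text \<open>Each of the finitely many separable quadruples is separated at some level, and raising
  \<open>F\<close> and \<open>n\<close> keeps it separated. At the common level, two neutral words
  of equal profile suffice to place a quadruple in the set.\<close>

lemma inseparable_quads_uniform:
  fixes G :: "('a :: finite) lang_class" and \<delta> :: "('q \<times> 'a \<times> 'q) set"
  assumes Q: "finite Q"
  shows "\<exists>F n. finite F \<and> F \<subseteq> G \<and> (\<forall>q\<in>Q. \<forall>r\<in>Q. \<forall>s\<in>Q. \<forall>t\<in>Q.
    profile_inseparable F n (nfa_lang \<delta> q r) (nfa_lang \<delta> s t) \<longrightarrow>
    (q, r, s, t) \<in> inseparable_quads (BPol (lang_class_plus G)) G Q \<delta>)"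
proof -
  define I where "I = inseparable_quads (BPol (lang_class_plus G)) G Q \<delta>"
  define bad where "bad F n d \<longleftrightarrow> (case d of (q, r, s, t) \<Rightarrow>
    profile_inseparable F n (nfa_lang \<delta> q r) (nfa_lang \<delta> s t))" for F n and d :: "'q \<times> 'q \<times> 'q \<times> 'q"
  have "\<exists>F n. finite F \<and> F \<subseteq> G \<and> (\<forall>d\<in>D. \<not> bad F n d)"
    if "finite D" "D \<subseteq> (Q \<times> Q \<times> Q \<times> Q) - I" for D
    using that
  proof induction
    case empty
    show ?case by (rule exI[of _ "{}"]) simp
  next
    case (insert d D)
    obtain F n where F: "finite F" "F \<subseteq> G" "\<forall>d\<in>D. \<not> bad F n d"
      using insert by auto
    obtain q r s t where d: "d = (q, r, s, t)"
      by (cases d) auto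
    have "separable_under_control (BPol (lang_class_plus G)) G (nfa_lang \<delta> q r) (nfa_lang \<delta> s t)"
      using insert.prems d by (auto simp: I_def inseparable_quads_def)
    from separable_imp_not_profile_inseparable[OF this]
    obtain F' n' where F': "finite F'" "F' \<subseteq> G" "\<not> bad F' n' d"
      unfolding bad_def d prod.case by (elim exE conjE)
    have "\<not> bad (F \<union> F') (max n n') e" if "e \<in> insert d D" for e
    proof -
      have "bad F n e \<and> bad F' n' e" if "bad (F \<union> F') (max n n') e"
        using that profile_inseparable_mono[of F "F \<union> F'" n "max n n'"]
          profile_inseparable_mono[of F' "F \<union> F'" n' "max n n'"]
        by (cases e) (simp add: bad_def)
      then show ?thesis
        using that F(3) F'(3) by blast
    qed
    then show ?case
      using F(1,2) F'(1,2) by (intro exI[of _ "F \<union> F'"] exI[of _ "max n n'"]) simp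
  qed
  from this[of "(Q \<times> Q \<times> Q \<times> Q) - I"] obtain F n where F: "finite F" "F \<subseteq> G"
    and not: "\<forall>d\<in>(Q \<times> Q \<times> Q \<times> Q) - I. \<not> bad F n d"
    using Q by auto
  have "(q, r, s, t) \<in> I" if "q \<in> Q" "r \<in> Q" "s \<in> Q" "t \<in> Q"
    "profile_inseparable F n (nfa_lang \<delta> q r) (nfa_lang \<delta> s t)" for q r s t
    using that not[rule_format, of "(q, r, s, t)"] by (auto simp: bad_def)
  then show ?thesis
    using F unfolding I_def by blast
qed

section \<open>Idempotent transition relations\<close>

text \<open>Otherwise \<open>E\<close> restricted to the intermediate points \<open>X\<close> is
  transitive and irreflexive, so by finiteness some point of \<open>X\<close> has no successor in
  \<open>X\<close>; but factoring its edge to \<open>b\<close> through \<open>E O E\<close> produces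
  one.\<close>

lemma idempotent_relation_loop:
  assumes "finite Q" and E: "E \<subseteq> Q \<times> Q" "E O E = E" and ab: "(a, b) \<in> E"
  shows "\<exists>c. (a, c) \<in> E \<and> (c, c) \<in> E \<and> (c, b) \<in> E"
proof (rule ccontr)
  assume no: "\<nexists>c. (a, c) \<in> E \<and> (c, c) \<in> E \<and> (c, b) \<in> E"
  define X where "X = {c. (a, c) \<in> E \<and> (c, b) \<in> E}"
  define R where "R = E \<inter> X \<times> X"
  have "finite R"
    using E(1) assms(1) by (auto simp: R_def intro: finite_subset)
  have "trans R"
    using E(2) unfolding R_def trans_def by blast
  then have "acyclic R"
    using no unfolding acyclic_def by (auto simp: R_def X_def)
  then have "wf (R\<inverse>)"
    using \<open>finite R\<close> by (rule finite_acyclic_wf_converse[rotated])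
  moreover obtain c where "c \<in> X"
    using ab E(2) unfolding X_def by blast
  ultimately obtain c where c: "c \<in> X" and max: "\<And>y. (y, c) \<in> R\<inverse> \<Longrightarrow> y \<notin> X"
    using wfE_min by metis
  obtain d where d: "(c, d) \<in> E" "(d, b) \<in> E"
    using c E(2) unfolding X_def by blast
  then have "(a, d) \<in> E"
    using c E(2) unfolding X_def by blast
  then show False
    using max[of d] d c unfolding R_def X_def by blast
qed

definition run_rel :: "('q \<times> 'a \<times> 'q) set \<Rightarrow> 'a list \<Rightarrow> ('q \<times> 'q) set" where
  "run_rel \<delta> w = {(p, q). nfa_run \<delta> p w q}"

lemma run_rel_append: "run_rel \<delta> (u @ v) = run_rel \<delta> u O run_rel \<delta> v"
  unfolding run_rel_def by (auto simp: nfa_run_append_iff)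

text \<open>The empty word is set apart because its relation is the identity on the whole state
  type; nonempty words relate only states in \<open>Q\<close>.\<close>

lemma finite_range_run_rel:
  assumes "is_nfa Q \<delta>"
  shows "finite (range (run_rel \<delta>))"
proof (rule finite_subset)
  have "run_rel \<delta> w \<subseteq> Q \<times> Q" if "w \<noteq> []" for w
    using nfa_run_states[OF assms _ that] by (auto simp: run_rel_def)
  then have "run_rel \<delta> w \<in> insert (run_rel \<delta> []) (Pow (Q \<times> Q))" for w
    by (cases "w = []") auto
  then show "range (run_rel \<delta>) \<subseteq> insert (run_rel \<delta> []) (Pow (Q \<times> Q))"
    by (rule image_subsetI)
  show "finite (insert (run_rel \<delta> []) (Pow (Q \<times> Q)))"
    using assms by (simp add: is_nfa_def)
qed

text \<open>Pairing makes an idempotent class both an idempotent transition relation and, in the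
  group quotient by \<open>syn F\<close>, the neutral element.\<close>

definition run_syn ::
  "('q \<times> 'a \<times> 'q) set \<Rightarrow> 'a lang set \<Rightarrow> 'a list \<Rightarrow> ('q \<times> 'q) set \<times> ('a lang \<times> 'a list \<times> 'a list) set"
  where "run_syn \<delta> F w = (run_rel \<delta> w, syn F w)"

lemma word_congruence_run_syn: "word_congruence (run_syn \<delta> F)"
  unfolding word_congruence_def
proof (intro allI impI)
  fix u u' v v' assume "run_syn \<delta> F u = run_syn \<delta> F u'" "run_syn \<delta> F v = run_syn \<delta> F v'"
  then show "run_syn \<delta> F (u @ v) = run_syn \<delta> F (u' @ v')"
    using word_congruenceD[OF word_congruence_syn[of F], of u u' v v']
    by (simp add: run_syn_def run_rel_append)
qed

lemma finite_range_run_syn: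
  assumes "is_nfa Q \<delta>" and "finite F" and "\<And>L. L \<in> F \<Longrightarrow> group_lang L"
  shows "finite (range (run_syn \<delta> F))"
proof (rule finite_subset)
  show "range (run_syn \<delta> F) \<subseteq> range (run_rel \<delta>) \<times> range (syn F)"
    by (auto simp: run_syn_def)
  show "finite (range (run_rel \<delta>) \<times> range (syn F))"
    using finite_range_run_rel[OF assms(1)] finite_range_syn[OF assms(2,3)] by simp
qed

text \<open>The guard word \<open>x\<close> provides loop states at the gap in all three components.
  The first one waits there while the others jump over \<open>x @ u @ x\<close> and
  \<open>x @ v @ x\<close>, neutral words of equal profile, which place the quadruple in
  \<open>S\<close>.\<close>

lemma eps_run_guarded:
  assumes nfa: "is_nfa Q \<delta>" and F: "finite F" "\<And>L. L \<in> F \<Longrightarrow> group_lang L"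
    and S: "\<And>q r s t. \<lbrakk>q \<in> Q; r \<in> Q; s \<in> Q; t \<in> Q;
      profile_inseparable F n (nfa_lang \<delta> q r) (nfa_lang \<delta> s t)\<rbrakk> \<Longrightarrow> (q, r, s, t) \<in> S"
    and guard: "guarded (run_syn \<delta> F) l r"
    and u: "syn F u = syn F []" and v: "syn F v = syn F []"
    and eq: "profile (syn_plus F) n u = profile (syn_plus F) n v"
    and runs: "nfa_run \<delta> p1 (l @ r) q1" "nfa_run \<delta> p2 (l @ u @ r) q2" "nfa_run \<delta> p3 (l @ v @ r) q3"
  shows "eps_run (gamma_plus Q \<delta> S) (p1, p2, p3) (l @ r) (q1, q2, q3)"
proof -
  from guard obtain x where x: "x \<noteq> []" "run_syn \<delta> F (x @ x) = run_syn \<delta> F x"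
    "run_syn \<delta> F (l @ x) = run_syn \<delta> F l" "run_syn \<delta> F (x @ r) = run_syn \<delta> F r"
    unfolding guarded_def by blast
  define E where "E = run_rel \<delta> x"
  \<comment> \<open>The only idempotent of a group is its neutral element.\<close>
  have x_syn: "syn F x = syn F []"
    using syn_cancel[OF F, of x x] x(2) by (simp add: run_syn_def)
  have E: "E O E = E" "run_rel \<delta> l O E = run_rel \<delta> l" "E O run_rel \<delta> r = run_rel \<delta> r"
    using x(2-4) by (simp_all add: run_syn_def run_rel_append E_def)
  have E_sub: "E \<subseteq> Q \<times> Q"
    using nfa_run_states[OF nfa _ x(1)] by (auto simp: E_def run_rel_def)
  have "finite Q"
    using nfa by (simp add: is_nfa_def)
  note loop = idempotent_relation_loop[OF \<open>finite Q\<close> E_sub E(1)]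
  \<comment> \<open>As \<open>l\<close> absorbs \<open>x\<close>, it already leads to a loop state
    from which \<open>x\<close> leads to \<open>a\<close>; \<open>right\<close> is the mirror
    image.\<close>
  have left: "\<exists>c. (p, c) \<in> run_rel \<delta> l \<and> (c, c) \<in> E \<and> (c, a) \<in> E" if pa: "(p, a) \<in> run_rel \<delta> l" for p a
  proof -
    from pa have "(p, a) \<in> run_rel \<delta> l O E"
      by (simp only: E(2))
    then obtain a' where "(p, a') \<in> run_rel \<delta> l" "(a', a) \<in> E"
      by blast
    moreover from loop[OF this(2)] obtain c where "(a', c) \<in> E" "(c, c) \<in> E" "(c, a) \<in> E"
      by blast
    ultimately show ?thesis
      using E(2) by blast
  qed
  have right: "\<exists>c. (b, c) \<in> E \<and> (c, c) \<in> E \<and> (c, p) \<in> run_rel \<delta> r" if bp: "(b, p) \<in> run_rel \<delta> r" for p b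
  proof -
    from bp have "(b, p) \<in> E O run_rel \<delta> r"
      by (simp only: E(3))
    then obtain b' where "(b, b') \<in> E" "(b', p) \<in> run_rel \<delta> r"
      by blast
    moreover from loop[OF this(1)] obtain c where "(b, c) \<in> E" "(c, c) \<in> E" "(c, b') \<in> E"
      by blast
    ultimately show ?thesis
      using E(3) by blast
  qed
  \<comment> \<open>In the first component a single loop state ends the run over \<open>l\<close>
    and starts the run over \<open>r\<close>.\<close>
  obtain c1 where c1: "(p1, c1) \<in> run_rel \<delta> l" "(c1, c1) \<in> E" "(c1, q1) \<in> run_rel \<delta> r"
  proof -
    obtain a where a: "(p1, a) \<in> run_rel \<delta> l" "(a, q1) \<in> run_rel \<delta> r"
      using runs(1) by (auto simp: nfa_run_append_iff run_rel_def)
    obtain c where "(p1, c) \<in> run_rel \<delta> l" "(c, c) \<in> E" "(c, a) \<in> E"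
      using left[OF a(1)] by blast
    then show thesis
      using that a(2) E(3) by blast
  qed
  have jump: "\<exists>c d. (p, c) \<in> run_rel \<delta> l \<and> (c, c) \<in> E \<and> x @ w @ x \<in> nfa_lang \<delta> c d \<and> (d, d) \<in> E \<and>
    (d, q) \<in> run_rel \<delta> r" if run: "nfa_run \<delta> p (l @ w @ r) q" for p w q
  proof -
    obtain a b where ab: "(p, a) \<in> run_rel \<delta> l" "nfa_run \<delta> a w b" "(b, q) \<in> run_rel \<delta> r"
      using run by (auto simp: nfa_run_append_iff run_rel_def)
    obtain c where c: "(p, c) \<in> run_rel \<delta> l" "(c, c) \<in> E" "(c, a) \<in> E"
      using left[OF ab(1)] by blast
    obtain d where d: "(b, d) \<in> E" "(d, d) \<in> E" "(d, q) \<in> run_rel \<delta> r"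
      using right[OF ab(3)] by blast
    have "nfa_run \<delta> c (x @ w @ x) d"
      using c(3) d(1) nfa_run_append[OF _ nfa_run_append[OF ab(2)], of c x x d]
      by (simp add: E_def run_rel_def)
    then show ?thesis
      using c d by (auto simp: nfa_lang_def)
  qed
  obtain c2 d2 where 2: "(p2, c2) \<in> run_rel \<delta> l" "(c2, c2) \<in> E" "x @ u @ x \<in> nfa_lang \<delta> c2 d2"
    "(d2, d2) \<in> E" "(d2, q2) \<in> run_rel \<delta> r"
    using jump[OF runs(2)] by blast
  obtain c3 d3 where 3: "(p3, c3) \<in> run_rel \<delta> l" "(c3, c3) \<in> E" "x @ v @ x \<in> nfa_lang \<delta> c3 d3"
    "(d3, d3) \<in> E" "(d3, q3) \<in> run_rel \<delta> r"
    using jump[OF runs(3)] by blast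
  note D = word_congruenceD[OF word_congruence_syn[of F]]
  have "syn F (x @ w @ x) = syn F []" if "syn F w = syn F []" for w
    using D[OF x_syn D[OF that x_syn]] by simp
  then have "syn F (x @ u @ x) = syn F []" "syn F (x @ v @ x) = syn F []"
    using u v by blast+
  moreover have "profile (syn_plus F) n (x @ u @ x) = profile (syn_plus F) n (x @ v @ x)"
    using eq by (intro equalityI profile_append_mono word_congruence_syn_plus) simp_all
  ultimately have "profile_inseparable F n (nfa_lang \<delta> c2 d2) (nfa_lang \<delta> c3 d3)"
    unfolding profile_inseparable_def using 2(3) 3(3)
    by (intro bexI[of _ "x @ u @ x"] bexI[of _ "x @ v @ x"] conjI)
  then have "(c2, d2, c3, d3) \<in> S"
    using 2 3 E_sub by (intro S) auto
  moreover have "c1 \<in> Q"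
    using c1 E_sub by blast
  moreover have "x \<in> nonempty_words \<inter> nfa_lang \<delta> c1 c1 \<inter> nfa_lang \<delta> c2 c2 \<inter> nfa_lang \<delta> c3 c3 \<inter>
    nfa_lang \<delta> d2 d2 \<inter> nfa_lang \<delta> d3 d3"
    using x(1) c1(2) 2(2,4) 3(2,4) by (simp add: E_def run_rel_def nfa_lang_def nonempty_words_def)
  ultimately have jump_trans: "((c1, c2, c3), None, (c1, d2, d3)) \<in> gamma_plus Q \<delta> S"
    unfolding gamma_plus_def by blast
  have "eps_run (gamma_plus Q \<delta> S) (p1, p2, p3) l (c1, c2, c3)"
    using c1(1) 2(1) 3(1) by (intro eps_run_gamma_plus) (simp_all add: run_rel_def)
  moreover have "eps_run (gamma_plus Q \<delta> S) (c1, d2, d3) r (q1, q2, q3)"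
    using c1(3) 2(5) 3(5) by (intro eps_run_gamma_plus) (simp_all add: run_rel_def)
  then have "eps_run (gamma_plus Q \<delta> S) (c1, c2, c3) r (q1, q2, q3)"
    by (rule eps_run_eps[OF jump_trans])
  ultimately show ?thesis
    by (rule eps_run_append)
qed

lemma eps_run_fill:
  assumes nfa: "is_nfa Q \<delta>" and F: "finite F" "\<And>L. L \<in> F \<Longrightarrow> group_lang L"
    and S: "\<And>q r s t. \<lbrakk>q \<in> Q; r \<in> Q; s \<in> Q; t \<in> Q;
      profile_inseparable F n (nfa_lang \<delta> q r) (nfa_lang \<delta> s t)\<rbrakk> \<Longrightarrow> (q, r, s, t) \<in> S"
    and len: "length us = length ps" "length ps = length gs"
    and "\<forall>(l, r)\<in>set ps. guarded (run_syn \<delta> F) l r"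
    and "\<forall>u\<in>set us. syn F u = syn F []" and "\<forall>g\<in>set gs. syn F g = syn F []"
    and "list_all2 (\<lambda>u g. profile (syn_plus F) n u = profile (syn_plus F) n g) us gs"
    and "nfa_run \<delta> p1 (fill ps (map (\<lambda>_. []) ps) z) q1" "nfa_run \<delta> p2 (fill ps us z) q2"
      "nfa_run \<delta> p3 (fill ps gs z) q3"
  shows "eps_run (gamma_plus Q \<delta> S) (p1, p2, p3) (fill ps (map (\<lambda>_. []) ps) z) (q1, q2, q3)"
  using len assms(7-)
proof (induction us ps gs arbitrary: p1 p2 p3 rule: list_induct3)
  case Nil
  then have "nfa_run \<delta> p1 z q1" "nfa_run \<delta> p2 z q2" "nfa_run \<delta> p3 z q3"
    by (simp_all only: fill.simps list.map)
  then show ?case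
    unfolding fill.simps list.map by (rule eps_run_gamma_plus)
next
  case (Cons u us p ps g gs)
  obtain l r where p: "p = (l, r)"
    by (cases p)
  let ?f = "fill ps (map (\<lambda>_. []) ps) z"
  obtain a1 where a1: "nfa_run \<delta> p1 (l @ r) a1" "nfa_run \<delta> a1 ?f q1"
    using Cons.prems(5) nfa_run_append_iff[of \<delta> p1 "l @ r" ?f q1] by (auto simp: p)
  obtain a2 where a2: "nfa_run \<delta> p2 (l @ u @ r) a2" "nfa_run \<delta> a2 (fill ps us z) q2"
    using Cons.prems(6) nfa_run_append_iff[of \<delta> p2 "l @ u @ r" "fill ps us z" q2] by (auto simp: p)
  obtain a3 where a3: "nfa_run \<delta> p3 (l @ g @ r) a3" "nfa_run \<delta> a3 (fill ps gs z) q3"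
    using Cons.prems(7) nfa_run_append_iff[of \<delta> p3 "l @ g @ r" "fill ps gs z" q3] by (auto simp: p)
  have "eps_run (gamma_plus Q \<delta> S) (p1, p2, p3) (l @ r) (a1, a2, a3)"
  proof (rule eps_run_guarded[OF nfa F S _ _ _ _ a1(1) a2(1) a3(1)])
    show "guarded (run_syn \<delta> F) l r" "syn F u = syn F []" "syn F g = syn F []"
      using Cons.prems(1-3) by (simp_all add: p)
    show "profile (syn_plus F) n u = profile (syn_plus F) n g"
      using Cons.prems(4) unfolding list_all2_Cons by (rule conjunct1)
  qed
  moreover have "eps_run (gamma_plus Q \<delta> S) (a1, a2, a3) ?f (q1, q2, q3)"
    by (rule Cons.IH[OF _ _ _ _ a1(2) a2(2) a3(2)]) (use Cons.prems(1-4) in simp_all)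
  ultimately have "eps_run (gamma_plus Q \<delta> S) (p1, p2, p3) ((l @ r) @ ?f) (q1, q2, q3)"
    by (rule eps_run_append)
  then show ?case
    by (simp add: p)
qed

lemma inseparable_quads_not_separable:
  fixes G :: "('a :: finite) lang_class" and Q :: "'q set" and \<delta> :: "('q \<times> 'a \<times> 'q) set"
  defines "I \<equiv> inseparable_quads (BPol (lang_class_plus G)) G Q \<delta>"
  assumes G: "group_prevariety G" and nfa: "is_nfa Q \<delta>" and qrst: "(q, r, s, t) \<in> I"
  shows "\<not> separable G {[]} (eps_lang (gamma_plus Q \<delta> I) (s, q, s) (t, r, t))"
proof
  assume "separable G {[]} (eps_lang (gamma_plus Q \<delta> I) (s, q, s) (t, r, t))"
  then obtain K where K: "K \<in> G" "[] \<in> K"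
    "K \<inter> eps_lang (gamma_plus Q \<delta> I) (s, q, s) (t, r, t) = {}"
    unfolding separable_def by blast
  have "finite Q"
    using nfa by (simp add: is_nfa_def)
  \<comment> \<open>\<open>k\<close> is the level at which gaps are compared; the bound
    \<open>n\<close> obtained below is the level for whole words.\<close>
  from inseparable_quads_uniform[OF this, of G \<delta>] obtain F0 k where F0: "finite F0" "F0 \<subseteq> G"
    and F0_insep: "\<forall>q\<in>Q. \<forall>r\<in>Q. \<forall>s\<in>Q. \<forall>t\<in>Q. profile_inseparable F0 k (nfa_lang \<delta> q r) (nfa_lang \<delta> s t) \<longrightarrow>
      (q, r, s, t) \<in> I"
    unfolding I_def by (elim exE conjE)
  \<comment> \<open>With \<open>K\<close> in \<open>F\<close>, every neutral word lies in
    \<open>K\<close>; a neutral word read by the automaton then refutes separation.\<close>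
  define F where "F = insert K F0"
  have F: "finite F" "F \<subseteq> G"
    using F0 K(1) by (auto simp: F_def)
  have insep: "(q, r, s, t) \<in> I" if "q \<in> Q" "r \<in> Q" "s \<in> Q" "t \<in> Q"
    "profile_inseparable F k (nfa_lang \<delta> q r) (nfa_lang \<delta> s t)" for q r s t
    using F0_insep that profile_inseparable_mono[OF _ order_refl that(5), of F0]
    by (auto simp: F_def)
  have grp: "\<And>L. L \<in> F \<Longrightarrow> group_lang L"
    using F(2) G by (auto simp: group_prevariety_def)
  let ?h = "syn_plus F" and ?\<alpha> = "run_syn \<delta> F"
  have fin_h: "finite (range ?h)"
    by (rule finite_range_syn_plus[OF F(1) grp])
  obtain N where N: "\<forall>g. \<exists>P. tmpl ?h N P \<and> g \<in> P \<and> (\<forall>w\<in>P. profile ?h k g \<subseteq> profile ?h k w)"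
    using tmpl_cover[OF word_congruence_syn_plus fin_h, of k] by blast
  have "finite (range ?\<alpha>)"
    by (rule finite_range_run_syn[OF nfa F(1) grp])
  from guarded_decomposition[OF word_congruence_run_syn this, of N]
  obtain n where n: "\<forall>v. \<exists>ps gs z. v = fill ps gs z \<and> length gs = length ps \<and>
    (\<forall>(l, r)\<in>set ps. r \<noteq> [] \<and> guarded ?\<alpha> l r) \<and> (\<forall>g\<in>set gs. \<exists>u. ?\<alpha> (u @ g) = ?\<alpha> u) \<and>
    ?\<alpha> (fill ps (map (\<lambda>_. []) ps) z) = ?\<alpha> v \<and> fill_cost N ps z \<le> n"
    by (elim exE)
  have "profile_inseparable F n (nfa_lang \<delta> q r) (nfa_lang \<delta> s t)"
    using qrst unfolding I_def inseparable_quads_def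
    by (intro inseparable_imp_profile_inseparable[OF G F]) simp
  then obtain u v where uv: "nfa_run \<delta> q u r" "nfa_run \<delta> s v t" "syn F v = syn F []"
    and eq: "profile ?h n u = profile ?h n v"
    unfolding profile_inseparable_def nfa_lang_def by blast
  obtain ps gs z where v: "v = fill ps gs z" "length gs = length ps"
    and ps: "\<forall>(l, r)\<in>set ps. r \<noteq> [] \<and> guarded ?\<alpha> l r" and gs: "\<forall>g\<in>set gs. \<exists>u. ?\<alpha> (u @ g) = ?\<alpha> u"
    and f: "?\<alpha> (fill ps (map (\<lambda>_. []) ps) z) = ?\<alpha> v" and cost: "fill_cost N ps z \<le> n"
    using n[rule_format, of v] by (elim exE conjE)
  \<comment> \<open>Each gap is absorbed by some prefix, hence neutral by cancellation.\<close>
  have gs_syn: "\<forall>g\<in>set gs. syn F g = syn F []"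
    using gs syn_cancel[OF F(1) grp] unfolding run_syn_def by blast
  have "\<forall>(l, r)\<in>set ps. r \<noteq> []"
    using ps by auto
  from fill_transfer[OF fin_h syn_plus_Nil N this cost eq v]
  obtain us gs' where us: "u = fill ps us z" "v = fill ps gs' z"
    "list_all2 (\<lambda>x y. profile ?h k x = profile ?h k y) us gs'" "length gs' = length ps"
    "map ?h gs' = map ?h gs"
    by (elim exE conjE)
  have len: "length us = length ps"
    using us(3,4) by (simp add: list_all2_lengthD)
  have gs'_syn: "\<forall>g\<in>set gs'. syn F g = syn F []"
  proof
    fix g assume "g \<in> set gs'"
    then have "?h g \<in> set (map ?h gs)"
      unfolding us(5)[symmetric] by simp
    then show "syn F g = syn F []"
      using gs_syn by (auto simp: syn_plus_eq_iff)
  qed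
  have us_syn: "\<forall>w\<in>set us. syn F w = syn F []"
  proof
    fix w assume "w \<in> set us"
    then obtain i where "i < length us" "w = us ! i"
      by (auto simp: in_set_conv_nth)
    then have "gs' ! i \<in> set gs'" "profile ?h k w = profile ?h k (gs' ! i)"
      using us(3) by (auto simp: list_all2_conv_all_nth)
    then show "syn F w = syn F []"
      using gs'_syn profile_eqD[of ?h k w "gs' ! i"] by (simp add: syn_plus_eq_iff)
  qed
  let ?f = "fill ps (map (\<lambda>_. []) ps) z"
  \<comment> \<open>Erasing the gaps keeps the class of \<open>v\<close>, both as a transition
    relation and modulo \<open>syn F\<close>.\<close>
  have f': "nfa_run \<delta> s ?f t" "syn F ?f = syn F []"
    using f uv(2,3) by (auto simp: run_syn_def run_rel_def set_eq_iff)
  have "eps_run (gamma_plus Q \<delta> I) (s, q, s) ?f (t, r, t)"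
  proof (rule eps_run_fill[OF nfa F(1) grp insep len us(4)[symmetric] _ us_syn gs'_syn us(3) f'(1)])
    show "nfa_run \<delta> q (fill ps us z) r" "nfa_run \<delta> s (fill ps gs' z) t"
      using uv(1,2) us(1,2) by simp_all
    show "\<forall>(l, r)\<in>set ps. guarded ?\<alpha> l r"
      using ps by auto
  qed
  then have "?f \<in> eps_lang (gamma_plus Q \<delta> I) (s, q, s) (t, r, t)"
    by (simp add: eps_lang_def)
  moreover have "?f \<in> K"
    using syn_memD[OF f'(2), of K] K(2) by (simp add: F_def)
  ultimately show False
    using K(3) by blast
qed

theorem theorem22:
  fixes G :: "('a :: finite) lang_class"
    and Q :: "'q set"
    and \<delta> :: "('q \<times> 'a \<times> 'q) set"
  assumes "group_prevariety G"
    and "is_nfa Q \<delta>"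
  shows "BPol_plus_sound G Q \<delta> (inseparable_quads (BPol (lang_class_plus G)) G Q \<delta>) \<and>
    (\<forall>S. BPol_plus_sound G Q \<delta> S \<longrightarrow> S \<subseteq> inseparable_quads (BPol (lang_class_plus G)) G Q \<delta>)"
proof -
  let ?I = "inseparable_quads (BPol (lang_class_plus G)) G Q \<delta>"
  note sub = sound_subset_inseparable_quads[OF assms(1)]
  have Q: "?I \<subseteq> Q \<times> Q \<times> Q \<times> Q"
    by (auto simp: inseparable_quads_def)
  have le: "?I \<subseteq> tau_plus G Q \<delta> ?I"
  proof
    fix x assume "x \<in> ?I"
    then obtain q r s t where x: "x = (q, r, s, t)" "(q, r, s, t) \<in> ?I"
      by (cases x) auto
    \<comment> \<open>The second condition is the first one for the exchanged quadruple
      \<open>(s, t, q, r)\<close>.\<close>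
    show "x \<in> tau_plus G Q \<delta> ?I"
      using inseparable_quads_not_separable[OF assms x(2)]
        inseparable_quads_not_separable[OF assms inseparable_quads_sym[OF x(2)]] x Q
      by (auto simp: tau_plus_def)
  qed
  \<comment> \<open>By monotonicity the image of \<open>?I\<close> is again contained in its own
    image, so the upper bound applies to it.\<close>
  moreover have "tau_plus G Q \<delta> ?I \<subseteq> ?I"
    by (rule sub) (rule tau_plus_mono[OF le])
  ultimately have "BPol_plus_sound G Q \<delta> ?I"
    using Q unfolding BPol_plus_sound_def by blast
  moreover have "S \<subseteq> ?I" if "BPol_plus_sound G Q \<delta> S" for S
    using that by (intro sub) (simp add: BPol_plus_sound_def)
  ultimately show ?thesis by blast
qed

end
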